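(* Let $(R,\mathfrak m)$ be a local artinian principal ideal ring, $M$ a finitely generated $R$-module, $N$ an $R$-module with $N\cong_R R$, and $\langle\,,\rangle:M\times M\to N$ a non-degenerate symmetric $R$-bilinear form. Let $d\in\mathbf{Z}_{\ge2}$ be minimal such that $\perp_{i\ge d,\ i\text{ even}}\rho_i(M)$ and $\perp_{i\ge d,\ i\text{ odd}}\rho_i(M)$ are anisotropic over $R/\mathfrak m$. Then $\mathrm{rr}(M)\supseteq\mathrm{lr}_{d-1}(M)$.
   Context: For an ideal $I$, $M[I]=\{x\in M:Ix=0\}$; for $r\in R$, $M[r]=\{x\in M:rx=0\}$. Non-degenerate means $M\to\mathrm{Hom}_R(M,N)$, $m\mapsto\langle m,\cdot\rangle$, is an isomorphism. $L^{\perp}=\{a\in M:\langle a,L\rangle=0\}$. The radical root is $\mathrm{rr}(M)=\bigcap L$, the intersection over all submodules $L\subseteq M$ with $L\subseteq L^{\perp}$ and $L^{\perp}/L$ semi-simple. For $s\in\mathbf{Z}$, $$\mathrm{lr}_s(M)=\sum_{i\in\mathbf{Z}_{\ge0}}\left(\mathfrak m^iM\cap M[\mathfrak m^{i-s+1}]\right),$$ where $M[\mathfrak m^{-t}]=0$ for $t\ge0$. Put $\mathrm{lr}(M)=\sum_{r\in R}(rM\cap M[r])\subseteq\mathrm{ur}(M)=\bigcap_{r\in R}(rM+M[r])$. For odd $i\ge1$ put $$\rho_i(M)=\mathfrak m^{\lfloor i/2\rfloor}M[\mathfrak m^i]\big/\left(\mathfrak m^{\lfloor i/2\rfloor}M[\mathfrak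 m^{i-1}]+\mathfrak m^{\lfloor i/2\rfloor+1}M[\mathfrak m^{i+1}]\right),$$ and for even $i\ge2$ put $\rho_i(M)=\rho_{i-1}(M/M[\mathfrak m])$; these are $R/\mathfrak m$-vector spaces. The natural maps $([x_i])_i\mapsto[\sum_ix_i]$ are isomorphisms $\bigoplus_{i\text{ odd}}\rho_i(M)\cong\mathrm{ur}(M)/\mathrm{lr}(M)$ and $\bigoplus_{i\ge2\text{ even}}\rho_i(M)\cong\mathrm{ur}(M/M[\mathfrak m])/\mathrm{lr}(M/M[\mathfrak m])$. On $\mathrm{ur}(M)/\mathrm{lr}(M)$ one has the form $([x],[y])\mapsto\langle x,y\rangle\in N[\mathfrak m]$, and on $\mathrm{ur}(M/M[\mathfrak m])/\mathrm{lr}(M/M[\mathfrak m])$ the form induced in the same way by the form $M/M[\mathfrak m]\times M/M[\mathfrak m]\to N/N[\mathfrak m]$, with values in $N[\mathfrak m^2]/N[\mathfrak m]$. Transporting these along the isomorphisms gives symmetric bilinear forms over $R/\mathfrak m$ on the direct sums of the $\rho_i(M)$, $i$ odd, resp. even, for which the sums are orthogonal ($\perp$); sub-sums carry the restricted forms. A form is anisotropic if $\langle v,v\rangle\neq0$ for all nonzero $v$ (in particular the form on the zero space is anisotropic). *)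

theory Defs
  imports "HOL-Algebra.Module" "HOL-Algebra.Ideal_Product" "HOL-Algebra.Product_Groups"
begin

section \<open>Rings\<close>

locale local_ring = cring R + maximalideal \<mm> R for \<mm> and R (structure) +
  assumes maximal_unique: "maximalideal J R \<Longrightarrow> J = \<mm>"

locale artinian_ring = ring R for R (structure) +
  assumes descending_chain:
    "\<lbrakk>\<And>n::nat. ideal (I n) R; \<And>n. I (Suc n) \<subseteq> I n\<rbrakk> \<Longrightarrow> \<exists>n. \<forall>k\<ge>n. I k = I n"

locale principal_ideal_ring = cring R for R (structure) +
  assumes principal: "ideal I R \<Longrightarrow> principalideal I R"

abbreviation ideal_pow :: "('a, 'r) ring_scheme \<Rightarrow> 'a set \<Rightarrow> nat \<Rightarrow> 'a set" where
  "ideal_pow R I n \<equiv> I [^]\<^bsub>ideals_set R\<^esub> n"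


section \<open>Modules\<close>

definition gen_submodule ::
  "('a, 'r) ring_scheme \<Rightarrow> ('a, 'b, 'm) module_scheme \<Rightarrow> 'b set \<Rightarrow> 'b set" where
  "gen_submodule R M S = \<Inter>{H. submodule H R M \<and> S \<subseteq> H}"

definition fin_gen_module :: "('a, 'r) ring_scheme \<Rightarrow> ('a, 'b, 'm) module_scheme \<Rightarrow> bool" where
  "fin_gen_module R M \<longleftrightarrow>
     module R M \<and> (\<exists>S. finite S \<and> S \<subseteq> carrier M \<and> gen_submodule R M S = carrier M)"

text \<open>The module structures constructed below do not use the ring-like fields \<^const>\<open>mult\<close> and
  \<^const>\<open>one\<close> which the record type of modules inherits; they are left \<^const>\<open>undefined\<close>.\<close>

definition ring_as_module :: "('a, 'r) ring_scheme \<Rightarrow> ('a, 'a) module" where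
  "ring_as_module R =
     \<lparr>carrier = carrier R, mult = undefined, one = undefined,
      zero = \<zero>\<^bsub>R\<^esub>, add = (\<oplus>\<^bsub>R\<^esub>), smult = (\<otimes>\<^bsub>R\<^esub>)\<rparr>"

text \<open>The class of \<open>r \<odot> x\<close> is \<open>H + r \<odot> (H + x)\<close>; the summand \<open>H\<close> is needed since \<open>r \<odot> H\<close> may be
  smaller than \<open>H\<close>. A subquotient \<open>K / H\<close> is written \<open>quot_module (M\<lparr>carrier := K\<rparr>) H\<close>.\<close>

definition quot_module :: "('a, 'b, 'm) module_scheme \<Rightarrow> 'b set \<Rightarrow> ('a, 'b set) module" where
  "quot_module M H =
     \<lparr>carrier = a_rcosets\<^bsub>M\<^esub> H, mult = undefined, one = undefined,
      zero = H, add = (<+>\<^bsub>M\<^esub>), smult = (\<lambda>r X. H <+>\<^bsub>M\<^esub> ((\<lambda>x. r \<odot>\<^bsub>M\<^esub> x) ` X))\<rparr>"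

definition mod_hom ::
  "('a, 'r) ring_scheme \<Rightarrow> ('a, 'b, 'm) module_scheme \<Rightarrow> ('a, 'c, 'n) module_scheme \<Rightarrow> ('b \<Rightarrow> 'c) set" where
  "mod_hom R M N =
     {f \<in> carrier M \<rightarrow>\<^sub>E carrier N.
        (\<forall>x\<in>carrier M. \<forall>y\<in>carrier M. f (x \<oplus>\<^bsub>M\<^esub> y) = f x \<oplus>\<^bsub>N\<^esub> f y) \<and>
        (\<forall>r\<in>carrier R. \<forall>x\<in>carrier M. f (r \<odot>\<^bsub>M\<^esub> x) = r \<odot>\<^bsub>N\<^esub> f x)}"

definition mod_iso ::
  "('a, 'r) ring_scheme \<Rightarrow> ('a, 'b, 'm) module_scheme \<Rightarrow> ('a, 'c, 'n) module_scheme \<Rightarrow> ('b \<Rightarrow> 'c) set" where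
  "mod_iso R M N = {f \<in> mod_hom R M N. bij_betw f (carrier M) (carrier N)}"

definition Hom_module ::
  "('a, 'r) ring_scheme \<Rightarrow> ('a, 'b, 'm) module_scheme \<Rightarrow> ('a, 'c, 'n) module_scheme \<Rightarrow> ('a, 'b \<Rightarrow> 'c) module" where
  "Hom_module R M N =
     \<lparr>carrier = mod_hom R M N, mult = undefined, one = undefined,
      zero = (\<lambda>x\<in>carrier M. \<zero>\<^bsub>N\<^esub>),
      add = (\<lambda>f g. \<lambda>x\<in>carrier M. f x \<oplus>\<^bsub>N\<^esub> g x),
      smult = (\<lambda>r f. \<lambda>x\<in>carrier M. r \<odot>\<^bsub>N\<^esub> f x)\<rparr>"

definition simple_module :: "('a, 'r) ring_scheme \<Rightarrow> ('a, 'b, 'm) module_scheme \<Rightarrow> bool" where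
  "simple_module R M \<longleftrightarrow>
     carrier M \<noteq> {\<zero>\<^bsub>M\<^esub>} \<and> (\<forall>H. submodule H R M \<longrightarrow> H = {\<zero>\<^bsub>M\<^esub>} \<or> H = carrier M)"

definition semisimple_module :: "('a, 'r) ring_scheme \<Rightarrow> ('a, 'b, 'm) module_scheme \<Rightarrow> bool" where
  "semisimple_module R M \<longleftrightarrow>
     (\<exists>\<S>. (\<forall>S\<in>\<S>. submodule S R M \<and> simple_module R (M\<lparr>carrier := S\<rparr>)) \<and>
          gen_submodule R M (\<Union>\<S>) = carrier M \<and>
          (\<forall>S\<in>\<S>. S \<inter> gen_submodule R M (\<Union>(\<S> - {S})) = {\<zero>\<^bsub>M\<^esub>}))"

definition ideal_smult ::
  "('a, 'r) ring_scheme \<Rightarrow> ('a, 'b, 'm) module_scheme \<Rightarrow> 'a set \<Rightarrow> 'b set \<Rightarrow> 'b set" where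
  "ideal_smult R M I X = gen_submodule R M {a \<odot>\<^bsub>M\<^esub> x | a x. a \<in> I \<and> x \<in> X}"

definition elt_smult :: "('a, 'b, 'm) module_scheme \<Rightarrow> 'a \<Rightarrow> 'b set" where
  "elt_smult M r = (\<lambda>x. r \<odot>\<^bsub>M\<^esub> x) ` carrier M"

definition ideal_tors :: "('a, 'b, 'm) module_scheme \<Rightarrow> 'a set \<Rightarrow> 'b set" where
  "ideal_tors M I = {x \<in> carrier M. \<forall>a\<in>I. a \<odot>\<^bsub>M\<^esub> x = \<zero>\<^bsub>M\<^esub>}"

definition elt_tors :: "('a, 'b, 'm) module_scheme \<Rightarrow> 'a \<Rightarrow> 'b set" where
  "elt_tors M r = {x \<in> carrier M. r \<odot>\<^bsub>M\<^esub> x = \<zero>\<^bsub>M\<^esub>}"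

definition lr :: "('a, 'r) ring_scheme \<Rightarrow> ('a, 'b, 'm) module_scheme \<Rightarrow> 'b set" where
  "lr R M = gen_submodule R M (\<Union>r\<in>carrier R. elt_smult M r \<inter> elt_tors M r)"

definition ur :: "('a, 'r) ring_scheme \<Rightarrow> ('a, 'b, 'm) module_scheme \<Rightarrow> 'b set" where
  "ur R M = (\<Inter>r\<in>carrier R. elt_smult M r <+>\<^bsub>M\<^esub> elt_tors M r)"

text \<open>For \<open>i - s + 1 \<le> 0\<close> the function \<^const>\<open>nat\<close> truncates the exponent to \<open>0\<close>, and
  \<open>M[\<mm>\<^sup>0] = M[R] = 0\<close>, which is the convention for nonpositive exponents.\<close>

definition lr_level ::
  "('a, 'r) ring_scheme \<Rightarrow> 'a set \<Rightarrow> ('a, 'b, 'm) module_scheme \<Rightarrow> int \<Rightarrow> 'b set" where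
  "lr_level R \<mm> M s =
     gen_submodule R M
       (\<Union>i::nat. ideal_smult R M (ideal_pow R \<mm> i) (carrier M) \<inter>
                  ideal_tors M (ideal_pow R \<mm> (nat (int i - s + 1))))"


section \<open>Symmetric bilinear forms\<close>

locale symmetric_bilinear_form = M: module R M + N: module R N
  for R (structure) and M (structure) and N (structure) and B :: "'b \<Rightarrow> 'b \<Rightarrow> 'c" +
  assumes form_closed: "\<lbrakk>x \<in> carrier M; y \<in> carrier M\<rbrakk> \<Longrightarrow> B x y \<in> carrier N"
    and form_add_left: "\<lbrakk>x \<in> carrier M; y \<in> carrier M; z \<in> carrier M\<rbrakk> \<Longrightarrow>
          B (x \<oplus>\<^bsub>M\<^esub> y) z = B x z \<oplus>\<^bsub>N\<^esub> B y z"
    and form_add_right: "\<lbrakk>x \<in> carrier M; y \<in> carrier M; z \<in> carrier M\<rbrakk> \<Longrightarrow>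
          B x (y \<oplus>\<^bsub>M\<^esub> z) = B x y \<oplus>\<^bsub>N\<^esub> B x z"
    and form_smult_left: "\<lbrakk>r \<in> carrier R; x \<in> carrier M; y \<in> carrier M\<rbrakk> \<Longrightarrow>
          B (r \<odot>\<^bsub>M\<^esub> x) y = r \<odot>\<^bsub>N\<^esub> B x y"
    and form_smult_right: "\<lbrakk>r \<in> carrier R; x \<in> carrier M; y \<in> carrier M\<rbrakk> \<Longrightarrow>
          B x (r \<odot>\<^bsub>M\<^esub> y) = r \<odot>\<^bsub>N\<^esub> B x y"
    and form_sym: "\<lbrakk>x \<in> carrier M; y \<in> carrier M\<rbrakk> \<Longrightarrow> B x y = B y x"

definition nondegenerate ::
  "('a, 'r) ring_scheme \<Rightarrow> ('a, 'b, 'm) module_scheme \<Rightarrow> ('a, 'c, 'n) module_scheme \<Rightarrow>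
   ('b \<Rightarrow> 'b \<Rightarrow> 'c) \<Rightarrow> bool" where
  "nondegenerate R M N B \<longleftrightarrow>
     (\<lambda>x\<in>carrier M. \<lambda>y\<in>carrier M. B x y) \<in> mod_iso R M (Hom_module R M N)"

definition perp ::
  "('a, 'b, 'm) module_scheme \<Rightarrow> ('a, 'c, 'n) module_scheme \<Rightarrow> ('b \<Rightarrow> 'b \<Rightarrow> 'c) \<Rightarrow> 'b set \<Rightarrow> 'b set" where
  "perp M N B L = {a \<in> carrier M. \<forall>x\<in>L. B a x = \<zero>\<^bsub>N\<^esub>}"

definition rr ::
  "('a, 'r) ring_scheme \<Rightarrow> ('a, 'b, 'm) module_scheme \<Rightarrow> ('a, 'c, 'n) module_scheme \<Rightarrow>
   ('b \<Rightarrow> 'b \<Rightarrow> 'c) \<Rightarrow> 'b set" where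
  "rr R M N B =
     carrier M \<inter>
     \<Inter>{L. submodule L R M \<and> L \<subseteq> perp M N B L \<and>
           semisimple_module R (quot_module (M\<lparr>carrier := perp M N B L\<rparr>) L)}"


section \<open>The spaces \<open>\<rho>\<^sub>i\<close> and their forms\<close>

abbreviation mod_soc ::
  "'a set \<Rightarrow> ('a, 'b, 'm) module_scheme \<Rightarrow> ('a, 'b set) module" where
  "mod_soc \<mm> M \<equiv> quot_module M (ideal_tors M \<mm>)"

definition rho_odd ::
  "('a, 'r) ring_scheme \<Rightarrow> 'a set \<Rightarrow> ('a, 'b, 'm) module_scheme \<Rightarrow> nat \<Rightarrow> ('a, 'b set) module" where
  "rho_odd R \<mm> M i =
     (let P = ideal_pow R \<mm>; k = i div 2 in
      quot_module
        (M\<lparr>carrier := ideal_smult R M (P k) (ideal_tors M (P i))\<rparr>)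
        (ideal_smult R M (P k) (ideal_tors M (P (i - 1))) <+>\<^bsub>M\<^esub>
         ideal_smult R M (P (k + 1)) (ideal_tors M (P (i + 1)))))"

definition rho_even ::
  "('a, 'r) ring_scheme \<Rightarrow> 'a set \<Rightarrow> ('a, 'b, 'm) module_scheme \<Rightarrow> nat \<Rightarrow> ('a, 'b set set) module" where
  "rho_even R \<mm> M i = rho_odd R \<mm> (mod_soc \<mm> M) (i - 1)"

abbreviation direct_sum :: "nat set \<Rightarrow> (nat \<Rightarrow> ('a, 'b, 'm) module_scheme) \<Rightarrow> (nat \<Rightarrow> 'b) monoid" where
  "direct_sum I \<rho> \<equiv> sum_group I (\<lambda>i. add_monoid (\<rho> i))"

text \<open>Functions on classes that are defined through representatives are written with
  \<^const>\<open>the_elem\<close>, applied to the set of values at all choices of representatives.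

  \<open>lr_class_sum\<close> is the map \<open>([x\<^sub>i])\<^sub>i \<mapsto> [\<Sum>\<^sub>i x\<^sub>i]\<close> from \<open>\<Oplus>\<^sub>i \<rho>\<^sub>i\<close> to \<open>ur(M)/lr(M)\<close>. The sum runs over the
  finite support only, because \<^const>\<open>finsum\<close> over an infinite set is \<open>0\<close>.\<close>

definition lr_class_sum ::
  "('a, 'r) ring_scheme \<Rightarrow> ('a, 'b, 'm) module_scheme \<Rightarrow> nat set \<Rightarrow>
   (nat \<Rightarrow> ('a, 'b set, 'k) module_scheme) \<Rightarrow> (nat \<Rightarrow> 'b set) \<Rightarrow> 'b set" where
  "lr_class_sum R M I \<rho> v =
     (let S = {i \<in> I. v i \<noteq> \<zero>\<^bsub>\<rho> i\<^esub>} in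
      the_elem ((\<lambda>x. lr R M +>\<^bsub>M\<^esub> (\<Oplus>\<^bsub>M\<^esub>i\<in>S. x i)) ` (\<Pi>\<^sub>E i\<in>S. v i)))"

definition class_form :: "('b \<Rightarrow> 'b \<Rightarrow> 'c) \<Rightarrow> 'b set \<Rightarrow> 'b set \<Rightarrow> 'c" where
  "class_form B X Y = the_elem ((\<lambda>(x, y). B x y) ` (X \<times> Y))"

text \<open>The form \<open>M/M[\<mm>] \<times> M/M[\<mm>] \<rightarrow> N/N[\<mm>]\<close>, \<open>([x], [y]) \<mapsto> [\<langle>x, y\<rangle>]\<close>.\<close>

definition mod_soc_form ::
  "'a set \<Rightarrow> ('a, 'c, 'n) module_scheme \<Rightarrow> ('b \<Rightarrow> 'b \<Rightarrow> 'c) \<Rightarrow> 'b set \<Rightarrow> 'b set \<Rightarrow> 'c set" where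
  "mod_soc_form \<mm> N B = class_form (\<lambda>x y. ideal_tors N \<mm> +>\<^bsub>N\<^esub> B x y)"

text \<open>The form on \<open>\<Oplus>\<^sub>i \<rho>\<^sub>i\<close> obtained by transport from \<open>ur(M)/lr(M)\<close>.\<close>

definition direct_sum_form ::
  "('a, 'r) ring_scheme \<Rightarrow> ('a, 'b, 'm) module_scheme \<Rightarrow> ('b \<Rightarrow> 'b \<Rightarrow> 'c) \<Rightarrow> nat set \<Rightarrow>
   (nat \<Rightarrow> ('a, 'b set, 'k) module_scheme) \<Rightarrow> (nat \<Rightarrow> 'b set) \<Rightarrow> (nat \<Rightarrow> 'b set) \<Rightarrow> 'c" where
  "direct_sum_form R M B I \<rho> v w =
     class_form B (lr_class_sum R M I \<rho> v) (lr_class_sum R M I \<rho> w)"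

text \<open>Anisotropy of the restriction of this form to the sub-sum over \<open>i \<ge> d\<close>.\<close>

definition tail_anisotropic ::
  "('a, 'r) ring_scheme \<Rightarrow> ('a, 'b, 'm) module_scheme \<Rightarrow> ('a, 'c, 'n) module_scheme \<Rightarrow>
   ('b \<Rightarrow> 'b \<Rightarrow> 'c) \<Rightarrow> nat set \<Rightarrow> (nat \<Rightarrow> ('a, 'b set, 'k) module_scheme) \<Rightarrow> nat \<Rightarrow> bool" where
  "tail_anisotropic R M N B I \<rho> d \<longleftrightarrow>
     (\<forall>v\<in>carrier (direct_sum I \<rho>).
        (\<forall>i\<in>I. i < d \<longrightarrow> v i = \<zero>\<^bsub>\<rho> i\<^esub>) \<and> v \<noteq> \<one>\<^bsub>direct_sum I \<rho>\<^esub> \<longrightarrow>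
        direct_sum_form R M B I \<rho> v v \<noteq> \<zero>\<^bsub>N\<^esub>)"

definition odd_tail_anisotropic ::
  "('a, 'r) ring_scheme \<Rightarrow> 'a set \<Rightarrow> ('a, 'b, 'm) module_scheme \<Rightarrow> ('a, 'c, 'n) module_scheme \<Rightarrow>
   ('b \<Rightarrow> 'b \<Rightarrow> 'c) \<Rightarrow> nat \<Rightarrow> bool" where
  "odd_tail_anisotropic R \<mm> M N B d \<longleftrightarrow>
     tail_anisotropic R M N B {i. odd i} (rho_odd R \<mm> M) d"

definition even_tail_anisotropic ::
  "('a, 'r) ring_scheme \<Rightarrow> 'a set \<Rightarrow> ('a, 'b, 'm) module_scheme \<Rightarrow> ('a, 'c, 'n) module_scheme \<Rightarrow>
   ('b \<Rightarrow> 'b \<Rightarrow> 'c) \<Rightarrow> nat \<Rightarrow> bool" where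
  "even_tail_anisotropic R \<mm> M N B d \<longleftrightarrow>
     tail_anisotropic R (mod_soc \<mm> M) (mod_soc \<mm> N) (mod_soc_form \<mm> N B)
       {i. even i \<and> 2 \<le> i} (rho_even R \<mm> M) d"

end

theory Submission
  imports Defs
begin

text \<open>Let \<open>p\<close> generate \<open>\<mm>\<close>. Every element of \<open>R\<close> is a unit times a power of the nilpotent element \<open>p\<close>
(\<open>local_artinian_principal_imp_chain_ring\<close>), so \<open>\<mm>\<^sup>i M = p\<^sup>i M\<close> and \<open>M[\<mm>\<^sup>i] = M[p\<^sup>i]\<close>.

Let \<open>L \<subseteq> L\<^sup>\<bottom>\<close> be a submodule with \<open>L\<^sup>\<bottom>/L\<close> semisimple; the claim is \<open>lr\<^sub>d\<^sub>-\<^sub>1(M) \<subseteq> L\<close>. Since \<open>N \<cong> R\<close>,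
functionals extend from submodules, so the non-degenerate form separates \<open>L\<close> from each point outside
it: \<open>L = L\<^sup>\<bottom>\<^sup>\<bottom>\<close> (\<open>nondegenerate_separates\<close>). It remains to see that every \<open>x \<in> L\<^sup>\<bottom>\<close> is orthogonal to
\<open>lr\<^sub>d\<^sub>-\<^sub>1(M)\<close>. A semisimple module is killed by \<open>p\<close>, so \<open>p x \<in> L\<close> and \<open>p \<langle>x, x\<rangle> = \<langle>x, p x\<rangle> = 0\<close>.

The elements orthogonal to \<open>lr\<^sub>h(M)\<close> are those of \<open>ur\<^sub>h(M) = \<Inter>\<^sub>i (M[p\<^sup>i] + p\<^sup>i\<^sup>-\<^sup>h\<^sup>+\<^sup>1 M)\<close>. On a cyclic module
\<open>R/p\<^sup>j R\<close> the element \<open>p\<^sup>e\<close> lies in \<open>ur\<^sub>h\<close> iff \<open>j - 2 e \<le> h\<close> or \<open>p\<^sup>e = 0\<close>, and \<open>j - 2 e\<close> is the exponent of the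
power of \<open>p\<close> that kills the value of a form on it. The submodules \<open>ur\<^sub>h(M)\<close> increase to \<open>M\<close>, and \<open>x\<close>
descends from \<open>ur\<^sub>h(M)\<close> to \<open>ur\<^sub>h\<^sub>-\<^sub>1(M)\<close> as long as \<open>h \<ge> d\<close>; hence \<open>x \<in> ur\<^sub>d\<^sub>-\<^sub>1(M)\<close>
(\<open>anisotropic_imp_in_ur_level\<close>).

The descent rests on the identity \<open>ur\<^sub>h(M) = \<Sum>\<^sub>t p\<^sup>t M[p\<^sup>h\<^sup>+\<^sup>2\<^sup>t]\<close> for \<open>h \<ge> 1\<close> (\<open>ur_level_finite_expansion\<close>,
\<open>pw_tors_in_ur_level\<close>), which avoids choosing a decomposition of \<open>M\<close> into cyclic modules. Write
\<open>x = \<Sum>\<^sub>t p\<^sup>t w\<^sub>t\<close> accordingly. If \<open>h = 2 k + 1\<close>, then \<open>p\<^sup>k w\<^sub>0, p\<^sup>k\<^sup>+\<^sup>1 w\<^sub>1, \<dots>\<close> represent classes in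
\<open>\<rho>\<^sub>h(M), \<rho>\<^sub>h\<^sub>+\<^sub>2(M), \<dots>\<close>, whose sum in \<open>ur(M)/lr(M)\<close> is the class of \<open>p\<^sup>k x\<close>. The form has the value
\<open>p\<^sup>2\<^sup>k \<langle>x, x\<rangle> = 0\<close> there, so by anisotropy all these classes vanish. This means
\<open>w\<^sub>t \<in> M[p\<^sup>h\<^sup>+\<^sup>2\<^sup>t\<^sup>-\<^sup>1] + p M[p\<^sup>h\<^sup>+\<^sup>2\<^sup>t\<^sup>+\<^sup>1]\<close> (\<open>anisotropic_imp_split\<close>), which puts \<open>x\<close> into \<open>ur\<^sub>h\<^sub>-\<^sub>1(M)\<close>. If
\<open>h = 2 k + 2\<close>, the same argument applies to the class of \<open>x\<close> in \<open>M/M[p]\<close>, with values in \<open>N/N[p]\<close>.\<close>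

section \<open>Local artinian principal ideal rings\<close>

lemma (in ring) ideal_Union_chain:
  assumes "C \<noteq> {}" and C: "subset.chain {I. ideal I R} C"
  shows "ideal (\<Union>C) R"
proof -
  have ideal: "ideal I R" if "I \<in> C" for I
    using C that unfolding pred_on.chain_def by blast
  have "\<exists>I\<in>C. x \<in> I \<and> y \<in> I" if "x \<in> \<Union>C" "y \<in> \<Union>C" for x y
    using C that unfolding pred_on.chain_def by blast
  then have "x \<oplus> y \<in> \<Union>C" if "x \<in> \<Union>C" "y \<in> \<Union>C" for x y
    using that ideal additive_subgroup.a_closed[OF ideal.axioms(1)] by (metis UnionI)
  moreover have "\<Union>C \<noteq> {}"
    using \<open>C \<noteq> {}\<close> additive_subgroup.zero_closed[OF ideal.axioms(1)[OF ideal]] by blast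
  moreover have "\<ominus> x \<in> \<Union>C" and "x \<in> carrier R" if "x \<in> \<Union>C" for x
    using that ideal additive_subgroup.a_inv_closed[OF ideal.axioms(1)] ideal.Icarr
    by (metis UnionE UnionI)+
  ultimately have "subgroup (\<Union>C) (add_monoid R)"
    by (intro add.subgroupI subsetI) auto
  then show ?thesis
  proof (rule idealI[OF ring_axioms])
    fix a x assume "a \<in> \<Union>C" and x: "x \<in> carrier R"
    then obtain I where I: "I \<in> C" "a \<in> I" by blast
    show "x \<otimes> a \<in> \<Union>C" and "a \<otimes> x \<in> \<Union>C"
      using ideal.I_l_closed[OF ideal[OF I(1)] I(2) x] ideal.I_r_closed[OF ideal[OF I(1)] I(2) x] I(1)
      by blast+
  qed
qed

text \<open>A non-unit lies in a maximal ideal by Zorn's lemma, and \<open>\<mm>\<close> is the only one.\<close>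

lemma (in local_ring) Units_if_notin_maximal:
  assumes a: "a \<in> carrier R" and "a \<notin> \<mm>"
  shows "a \<in> Units R"
proof (rule ccontr)
  assume "a \<notin> Units R"
  define S where "S = {I. ideal I R \<and> a \<in> I \<and> \<one> \<notin> I}"
  have "\<one> \<notin> PIdl a"
  proof
    assume "\<one> \<in> PIdl a"
    then obtain b where "b \<in> carrier R" "\<one> = b \<otimes> a" unfolding cgenideal_def by blast
    then show False using \<open>a \<notin> Units R\<close> a unfolding Units_def by (auto simp: m_comm)
  qed
  then have S0: "PIdl a \<in> S"
    using a by (simp add: S_def cgenideal_ideal cgenideal_self)
  have "\<exists>J\<in>S. \<forall>X\<in>S. J \<subseteq> X \<longrightarrow> X = J"
  proof (rule subset_Zorn)
    fix C assume C: "subset.chain S C"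
    show "\<exists>U\<in>S. \<forall>X\<in>C. X \<subseteq> U"
    proof (cases "C = {}")
      case True
      then show ?thesis using S0 by auto
    next
      case False
      have "subset.chain {I. ideal I R} C"
        using C unfolding pred_on.chain_def S_def by blast
      with False have "ideal (\<Union>C) R" by (rule ideal_Union_chain)
      moreover have "C \<subseteq> S" using C unfolding pred_on.chain_def by blast
      ultimately have "\<Union>C \<in> S" using False unfolding S_def by blast
      then show ?thesis by blast
    qed
  qed
  then obtain J where J: "J \<in> S" and max: "\<And>X. X \<in> S \<Longrightarrow> J \<subseteq> X \<Longrightarrow> X = J" by blast
  have "maximalideal J R"
  proof (rule maximalidealI)
    show "ideal J R" and "carrier R \<noteq> J" using J unfolding S_def by auto
    fix I assume I: "ideal I R" "J \<subseteq> I" "I \<subseteq> carrier R"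
    show "I = J \<or> I = carrier R"
    proof (cases "\<one> \<in> I")
      case True
      then show ?thesis using ideal.one_imp_carrier[OF I(1)] by simp
    next
      case False
      then show ?thesis using I J max[of I] unfolding S_def by blast
    qed
  qed
  then have "J = \<mm>" by (rule maximal_unique)
  then show False using J \<open>a \<notin> \<mm>\<close> unfolding S_def by simp
qed

text \<open>The working form of a local artinian principal ideal ring. The exponent in
\<open>unit_times_power\<close> need not be unique, since high powers of \<open>p\<close> vanish; zero is covered by those.\<close>

locale chain_ring = cring R for R (structure) +
  fixes p
  assumes uniformizer_closed [simp, intro]: "p \<in> carrier R"
    and uniformizer_nilpotent: "\<exists>n::nat. p [^] n = \<zero>"
    and unit_times_power: "r \<in> carrier R \<Longrightarrow> \<exists>u\<in>Units R. \<exists>k::nat. r = u \<otimes> p [^] k"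
    and one_neq_zero: "\<one> \<noteq> \<zero>"

text \<open>The chain of ideals generated by the powers of \<open>p\<close> stabilises: \<open>p\<^sup>n = r p\<^sup>n\<^sup>+\<^sup>1\<close> for some \<open>n\<close> and \<open>r\<close>. As
\<open>1 - r p\<close> is a unit, \<open>p\<^sup>n = 0\<close>. Given \<open>r \<noteq> 0\<close>, take out the highest power of \<open>p\<close> that divides it: the
cofactor is not in \<open>\<mm>\<close>.\<close>

lemma local_artinian_principal_imp_chain_ring:
  fixes R (structure)
  assumes "local_ring \<mm> R" and "artinian_ring R" and "principal_ideal_ring R"
  shows "\<exists>p. chain_ring R p \<and> \<mm> = PIdl p"
proof -
  interpret local_ring \<mm> R by fact
  interpret A: artinian_ring R by fact
  interpret P: principal_ideal_ring R by fact
  obtain p where p: "p \<in> carrier R" and m: "\<mm> = PIdl p"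
    using principalideal.generate[OF P.principal[OF is_ideal]] cgenideal_eq_genideal by metis
  have one_notin: "\<one> \<notin> \<mm>"
    using I_notcarr one_imp_carrier by metis
  have pk: "p [^] (k::nat) \<in> carrier R" for k using p by simp
  have "\<exists>n::nat. \<forall>k\<ge>n. PIdl (p [^] k) = PIdl (p [^] n)"
  proof (rule A.descending_chain)
    show "ideal (PIdl (p [^] n)) R" for n :: nat by (rule cgenideal_ideal[OF pk])
    show "PIdl (p [^] Suc n) \<subseteq> PIdl (p [^] n)" for n
    proof (rule cgenideal_minimal[OF cgenideal_ideal[OF pk]])
      show "p [^] Suc n \<in> PIdl (p [^] n)"
        using p pk[of n] unfolding cgenideal_def by (auto simp: m_comm)
    qed
  qed
  then obtain n where "PIdl (p [^] Suc n) = PIdl (p [^] n)" by (meson le_Suc_eq order_refl)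
  then have "p [^] n \<in> PIdl (p [^] Suc n)" using cgenideal_self[OF pk] by simp
  then obtain r where r: "r \<in> carrier R" "p [^] n = r \<otimes> p [^] Suc n"
    unfolding cgenideal_def by blast
  have rp: "r \<otimes> p \<in> \<mm>" using r p unfolding m cgenideal_def by blast
  have "\<one> \<ominus> r \<otimes> p \<notin> \<mm>"
  proof
    assume "\<one> \<ominus> r \<otimes> p \<in> \<mm>"
    then have "(\<one> \<ominus> r \<otimes> p) \<oplus> r \<otimes> p \<in> \<mm>" using rp by simp
    moreover have "(\<one> \<ominus> r \<otimes> p) \<oplus> r \<otimes> p = \<one>" using r p by (simp add: a_minus_def a_assoc l_neg)
    ultimately show False using one_notin by simp
  qed
  then have u: "\<one> \<ominus> r \<otimes> p \<in> Units R" using r p by (intro Units_if_notin_maximal) auto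
  have "(\<one> \<ominus> r \<otimes> p) \<otimes> p [^] n = p [^] n \<ominus> r \<otimes> p [^] Suc n"
    using r(1) p pk[of n] by (simp add: a_minus_def l_distr r_distr l_minus r_minus m_ac)
  also have "\<dots> = \<zero>" unfolding r(2)[symmetric] using pk by (simp add: a_minus_def r_neg)
  finally have "(\<one> \<ominus> r \<otimes> p) \<otimes> p [^] n = (\<one> \<ominus> r \<otimes> p) \<otimes> \<zero>"
    using r(1) p by simp
  then have nil: "p [^] n = \<zero>" using u pk[of n] Units_l_cancel by blast
  have "chain_ring R p"
  proof
    show "p \<in> carrier R" by fact
    show "\<exists>n::nat. p [^] n = \<zero>" using nil by blast
    show "\<one> \<noteq> \<zero>"
      using one_notin additive_subgroup.zero_closed[OF ideal.axioms(1)[OF is_ideal]] by auto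
    fix r assume r: "r \<in> carrier R"
    show "\<exists>u\<in>Units R. \<exists>k::nat. r = u \<otimes> p [^] k"
    proof (cases "r = \<zero>")
      case True
      then have "r = \<one> \<otimes> p [^] n" using nil by simp
      then show ?thesis by blast
    next
      case False
      let ?Q = "\<lambda>k::nat. r \<in> PIdl (p [^] k)"
      have bound: "k \<le> n" if "?Q k" for k
      proof (rule ccontr)
        assume "\<not> k \<le> n"
        then have "p [^] k = p [^] (k - n) \<otimes> p [^] n" using p by (simp add: nat_pow_mult)
        then have "p [^] k = \<zero>" using nil p by simp
        then show False using \<open>?Q k\<close> False unfolding cgenideal_def by auto
      qed
      have "?Q 0" using r unfolding cgenideal_def by force
      then obtain k where k: "?Q k" and max: "\<And>j. ?Q j \<Longrightarrow> j \<le> k"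
        using bound Nat.ex_has_greatest_nat[of ?Q 0 n] by blast
      from k obtain u where u: "u \<in> carrier R" "r = u \<otimes> p [^] k" unfolding cgenideal_def by blast
      have "u \<notin> \<mm>"
      proof
        assume "u \<in> \<mm>"
        then obtain s where s: "s \<in> carrier R" "u = s \<otimes> p" unfolding m cgenideal_def by blast
        then have "r = s \<otimes> p [^] Suc k" using u p by (simp add: m_ac)
        then have "?Q (Suc k)" using s unfolding cgenideal_def by blast
        then show False using max by fastforce
      qed
      then show ?thesis using u Units_if_notin_maximal by blast
    qed
  qed
  then show ?thesis using m by blast
qed

context chain_ring
begin

lemma power_closed [simp, intro]: "p [^] (k::nat) \<in> carrier R"
  by simp

lemma unit_times_power_eq_zeroD:
  assumes u: "u \<in> Units R" and "u \<otimes> p [^] (k::nat) = \<zero>"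
  shows "p [^] k = \<zero>"
proof -
  have "u \<otimes> p [^] k = u \<otimes> \<zero>" using assms by (simp add: Units_closed)
  then show ?thesis using u Units_l_cancel by (metis power_closed zero_closed)
qed

text \<open>In \<open>R\<close> an element killed by the annihilator of \<open>p\<^sup>k\<close> is a multiple of \<open>p\<^sup>k\<close>: if \<open>c\<close> is a unit times \<open>p\<^sup>i\<close>
with \<open>i < k\<close> and \<open>m\<close> is the nilpotency index of \<open>p\<close>, then \<open>p\<^sup>m\<^sup>-\<^sup>k c\<close> could vanish only if
\<open>m - k + i \<ge> m\<close>; and if \<open>k \<ge> m\<close>, then \<open>p\<^sup>k = 0\<close> and \<open>c = 0\<close>. This is the self-injectivity of \<open>R\<close>, in the form needed for extending functionals
by one element.\<close>

lemma dvd_power_if_annihilated: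
  assumes c: "c \<in> carrier R" and ann: "\<And>j::nat. p [^] (j + k) = \<zero> \<Longrightarrow> p [^] j \<otimes> c = \<zero>"
  shows "\<exists>e\<in>carrier R. c = p [^] k \<otimes> e"
proof -
  obtain u i where u: "u \<in> Units R" and ui: "c = u \<otimes> p [^] (i::nat)"
    using unit_times_power[OF c] by blast
  note uc = Units_closed[OF u]
  show ?thesis
  proof (cases "k \<le> i")
    case True
    then have "c = p [^] k \<otimes> (u \<otimes> p [^] (i - k))"
      using ui uc nat_pow_mult[of p k "i - k"] by (simp add: m_lcomm)
    then show ?thesis using uc by blast
  next
    case False
    define m where "m = (LEAST m::nat. p [^] m = \<zero>)"
    have m0: "p [^] m = \<zero>" unfolding m_def using uniformizer_nilpotent by (rule LeastI_ex)
    have min: "m \<le> l" if "p [^] l = \<zero>" for l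
      unfolding m_def using that by (rule Least_le)
    have "c = \<zero>"
    proof (cases "m \<le> k")
      case True
      have "p [^] k = p [^] (k - m) \<otimes> p [^] m" using True by (simp add: nat_pow_mult)
      then show ?thesis using ann[of 0] m0 c by simp
    next
      case m: False
      then have "p [^] (m - k) \<otimes> c = \<zero>" using ann[of "m - k"] m0 by simp
      then have "u \<otimes> p [^] (m - k + i) = \<zero>" using ui uc by (simp add: m_lcomm nat_pow_mult)
      then have "m \<le> m - k + i" using unit_times_power_eq_zeroD[OF u] min by blast
      then show ?thesis using False m by simp
    qed
    then show ?thesis by (intro bexI[of _ \<zero>]) simp_all
  qed
qed

lemma exists_socle_element:
  "\<exists>c\<in>carrier R. c \<noteq> \<zero> \<and> p \<otimes> c = \<zero>"
proof -
  define m where "m = (LEAST m::nat. p [^] m = \<zero>)"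
  have m0: "p [^] m = \<zero>" unfolding m_def using uniformizer_nilpotent by (rule LeastI_ex)
  then have "m \<noteq> 0" using one_neq_zero by (metis nat_pow_0)
  then obtain k where k: "m = Suc k" by (cases m) auto
  then have "p [^] k \<noteq> \<zero>" using not_less_Least[of k "\<lambda>m::nat. p [^] m = \<zero>"] by (simp add: m_def)
  moreover have "p \<otimes> p [^] k = \<zero>" using m0 k by (simp add: m_comm)
  ultimately show ?thesis by blast
qed

lemma ideal_pow_PIdl: "ideal_pow R (PIdl p) k = PIdl (p [^] k)"
proof (induction k)
  case 0
  have "PIdl \<one> = carrier R" unfolding cgenideal_def by force
  then show ?case by (simp add: ideals_set_def nat_pow_def)
next
  case (Suc k)
  have "ideal_pow R (PIdl p) (Suc k) = ideal_prod R (ideal_pow R (PIdl p) k) (PIdl p)"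
    by (simp add: ideals_set_def nat_pow_def)
  also have "\<dots> = ideal_prod R (PIdl (p [^] k)) (PIdl p)" using Suc by simp
  also have "\<dots> = PIdl (p [^] k \<otimes> p)"
    using ideal_prod_eq_genideal[OF cgenideal_ideal cgenideal_ideal] cgenideal_prod[of "p [^] k" p]
      cgenideal_eq_genideal[of "p [^] k \<otimes> p"]
    by (metis cgenideal_ideal genideal_minimal genideal_self m_closed power_closed
        uniformizer_closed subset_antisym order_refl ideal.axioms(1) additive_subgroup.a_subset)
  finally show ?case by simp
qed

end

section \<open>Submodules and quotients\<close>

context module
begin

lemma gen_submodule_minimal:
  "submodule H R M \<Longrightarrow> S \<subseteq> H \<Longrightarrow> gen_submodule R M S \<subseteq> H"
  unfolding gen_submodule_def by blast

lemma gen_submodule_id: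
  "submodule H R M \<Longrightarrow> gen_submodule R M H = H"
  unfolding gen_submodule_def by blast

lemma submodule_imp_abelian_subgroup:
  assumes "submodule H R M"
  shows "abelian_subgroup H M"
  using assms by (intro abelian_subgroupI3 additive_subgroup.intro)
    (simp_all add: submodule.axioms(1) M.abelian_group_axioms)

lemma submodule_minus:
  assumes "submodule H R M" "x \<in> H" "y \<in> H"
  shows "x \<ominus>\<^bsub>M\<^esub> y \<in> H"
  using submoduleE[OF assms(1)] assms(2,3) by (simp add: a_minus_def)

lemma submodule_zero:
  assumes "submodule H R M"
  shows "\<zero>\<^bsub>M\<^esub> \<in> H"
  using subgroup.one_closed[OF submodule.axioms(1)[OF assms]] by simp

lemma submodule_finsum:
  assumes H: "submodule H R M" and "\<And>i. i \<in> A \<Longrightarrow> f i \<in> H"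
  shows "(\<Oplus>\<^bsub>M\<^esub>i\<in>A. f i) \<in> H"
  using assms(2)
proof (induction A rule: infinite_finite_induct)
  case (insert a A)
  have "f \<in> A \<rightarrow> carrier M" "f a \<in> carrier M" using insert submoduleE(1)[OF H] by blast+
  then show ?case using insert submoduleE(5)[OF H] by simp
qed (simp_all add: submodule_zero[OF H])

lemma smult_minus_right:
  "\<lbrakk>a \<in> carrier R; x \<in> carrier M; y \<in> carrier M\<rbrakk> \<Longrightarrow>
   a \<odot>\<^bsub>M\<^esub> (x \<ominus>\<^bsub>M\<^esub> y) = a \<odot>\<^bsub>M\<^esub> x \<ominus>\<^bsub>M\<^esub> a \<odot>\<^bsub>M\<^esub> y"
  by (simp add: a_minus_def smult_r_distr smult_r_minus)

lemma diff_eq_zero_iff: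
  "\<lbrakk>x \<in> carrier M; y \<in> carrier M\<rbrakk> \<Longrightarrow> x \<ominus>\<^bsub>M\<^esub> y = \<zero>\<^bsub>M\<^esub> \<longleftrightarrow> x = y"
  by (metis M.minus_equality M.minus_minus M.r_neg a_minus_def M.a_inv_closed)

text \<open>The remainder of \<open>w\<close> modulo \<open>u + v\<close> can be absorbed into \<open>u\<close>.\<close>

lemma add_diff_split:
  assumes "w \<in> carrier M" "u \<in> carrier M" "v \<in> carrier M"
  shows "w = (u \<oplus>\<^bsub>M\<^esub> (w \<ominus>\<^bsub>M\<^esub> (u \<oplus>\<^bsub>M\<^esub> v))) \<oplus>\<^bsub>M\<^esub> v"
proof -
  have "(u \<oplus>\<^bsub>M\<^esub> (w \<ominus>\<^bsub>M\<^esub> (u \<oplus>\<^bsub>M\<^esub> v))) \<oplus>\<^bsub>M\<^esub> v = (w \<ominus>\<^bsub>M\<^esub> (u \<oplus>\<^bsub>M\<^esub> v)) \<oplus>\<^bsub>M\<^esub> (u \<oplus>\<^bsub>M\<^esub> v)"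
    using assms by (simp add: M.a_ac)
  also have "\<dots> = w" using assms by (simp add: a_minus_def M.a_assoc M.l_neg)
  finally show ?thesis by simp
qed

lemma smult_left_commute:
  "\<lbrakk>a \<in> carrier R; b \<in> carrier R; x \<in> carrier M\<rbrakk> \<Longrightarrow>
   a \<odot>\<^bsub>M\<^esub> (b \<odot>\<^bsub>M\<^esub> x) = b \<odot>\<^bsub>M\<^esub> (a \<odot>\<^bsub>M\<^esub> x)"
  by (metis R.m_comm smult_assoc1)

lemma submodule_smult_image:
  assumes r: "r \<in> carrier R" and H: "submodule H R M"
  shows "submodule ((\<lambda>x. r \<odot>\<^bsub>M\<^esub> x) ` H) R M"
proof -
  note H' = submoduleE[OF H] submodule_zero[OF H]
  show ?thesis
  proof (rule submoduleI)
    show "(\<lambda>x. r \<odot>\<^bsub>M\<^esub> x) ` H \<subseteq> carrier M" using r H' by blast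
    show "\<zero>\<^bsub>M\<^esub> \<in> (\<lambda>x. r \<odot>\<^bsub>M\<^esub> x) ` H"
      using r H' by (intro image_eqI[of _ _ "\<zero>\<^bsub>M\<^esub>"]) auto
    show "\<ominus>\<^bsub>M\<^esub> a \<in> (\<lambda>x. r \<odot>\<^bsub>M\<^esub> x) ` H" if a: "a \<in> (\<lambda>x. r \<odot>\<^bsub>M\<^esub> x) ` H" for a
    proof -
      obtain y where y: "y \<in> H" "a = r \<odot>\<^bsub>M\<^esub> y" using a by blast
      then have "\<ominus>\<^bsub>M\<^esub> a = r \<odot>\<^bsub>M\<^esub> (\<ominus>\<^bsub>M\<^esub> y)" using smult_r_minus[OF r] H'(1) by auto
      then show ?thesis using y H'(3) by blast
    qed
    show "a \<oplus>\<^bsub>M\<^esub> b \<in> (\<lambda>x. r \<odot>\<^bsub>M\<^esub> x) ` H"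
      if ab: "a \<in> (\<lambda>x. r \<odot>\<^bsub>M\<^esub> x) ` H" "b \<in> (\<lambda>x. r \<odot>\<^bsub>M\<^esub> x) ` H" for a b
    proof -
      obtain y z where yz: "y \<in> H" "a = r \<odot>\<^bsub>M\<^esub> y" "z \<in> H" "b = r \<odot>\<^bsub>M\<^esub> z" using ab by blast
      then have "a \<oplus>\<^bsub>M\<^esub> b = r \<odot>\<^bsub>M\<^esub> (y \<oplus>\<^bsub>M\<^esub> z)"
        using smult_r_distr[OF r, of y z] H'(1) by (simp add: subset_iff)
      then show ?thesis using yz H'(5) by blast
    qed
    show "s \<odot>\<^bsub>M\<^esub> x \<in> (\<lambda>x. r \<odot>\<^bsub>M\<^esub> x) ` H"
      if "s \<in> carrier R" "x \<in> (\<lambda>x. r \<odot>\<^bsub>M\<^esub> x) ` H" for s x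
    proof -
      from that obtain y where y: "y \<in> H" "x = r \<odot>\<^bsub>M\<^esub> y" by blast
      then have "s \<odot>\<^bsub>M\<^esub> x = r \<odot>\<^bsub>M\<^esub> (s \<odot>\<^bsub>M\<^esub> y)"
        using smult_left_commute[of s r y] r that(1) H'(1) by blast
      then show ?thesis using y that(1) H'(4) by blast
    qed
  qed
qed

lemma submodule_set_add:
  assumes H: "submodule H R M" and K: "submodule K R M"
  shows "submodule (H <+>\<^bsub>M\<^esub> K) R M"
proof -
  note H' = submoduleE[OF H] submodule_zero[OF H] and K' = submoduleE[OF K] submodule_zero[OF K]
  have mem: "x \<in> H <+>\<^bsub>M\<^esub> K \<longleftrightarrow> (\<exists>h\<in>H. \<exists>k\<in>K. x = h \<oplus>\<^bsub>M\<^esub> k)" for x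
    by (auto simp: set_add_def')
  show ?thesis
  proof (rule submoduleI)
    show "H <+>\<^bsub>M\<^esub> K \<subseteq> carrier M"
    proof
      fix x assume "x \<in> H <+>\<^bsub>M\<^esub> K"
      then obtain h k where "h \<in> H" "k \<in> K" "x = h \<oplus>\<^bsub>M\<^esub> k" unfolding mem by blast
      then show "x \<in> carrier M" using H'(1) K'(1) M.a_closed by blast
    qed
    show "\<zero>\<^bsub>M\<^esub> \<in> H <+>\<^bsub>M\<^esub> K"
      unfolding mem using submodule_zero[OF H] submodule_zero[OF K] by (metis M.l_zero M.zero_closed)
    show "\<ominus>\<^bsub>M\<^esub> a \<in> H <+>\<^bsub>M\<^esub> K" if a: "a \<in> H <+>\<^bsub>M\<^esub> K" for a
    proof -
      obtain h k where hk: "h \<in> H" "k \<in> K" "a = h \<oplus>\<^bsub>M\<^esub> k" using a unfolding mem by blast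
      then have "\<ominus>\<^bsub>M\<^esub> a = \<ominus>\<^bsub>M\<^esub> h \<oplus>\<^bsub>M\<^esub> \<ominus>\<^bsub>M\<^esub> k" using H'(1) K'(1) M.minus_add by blast
      then show ?thesis unfolding mem using hk H'(3) K'(3) by blast
    qed
    show "s \<odot>\<^bsub>M\<^esub> x \<in> H <+>\<^bsub>M\<^esub> K" if s: "s \<in> carrier R" and x: "x \<in> H <+>\<^bsub>M\<^esub> K" for s x
    proof -
      obtain h k where hk: "h \<in> H" "k \<in> K" "x = h \<oplus>\<^bsub>M\<^esub> k" using x unfolding mem by blast
      then have "s \<odot>\<^bsub>M\<^esub> x = s \<odot>\<^bsub>M\<^esub> h \<oplus>\<^bsub>M\<^esub> s \<odot>\<^bsub>M\<^esub> k" using s H'(1) K'(1) smult_r_distr by blast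
      then show ?thesis unfolding mem using s hk H'(4) K'(4) by blast
    qed
    show "a \<oplus>\<^bsub>M\<^esub> b \<in> H <+>\<^bsub>M\<^esub> K" if ab: "a \<in> H <+>\<^bsub>M\<^esub> K" "b \<in> H <+>\<^bsub>M\<^esub> K" for a b
    proof -
      obtain h k h' k' where "h \<in> H" "k \<in> K" "a = h \<oplus>\<^bsub>M\<^esub> k" "h' \<in> H" "k' \<in> K" "b = h' \<oplus>\<^bsub>M\<^esub> k'"
        using ab unfolding mem by blast
      moreover from this have "a \<oplus>\<^bsub>M\<^esub> b = (h \<oplus>\<^bsub>M\<^esub> h') \<oplus>\<^bsub>M\<^esub> (k \<oplus>\<^bsub>M\<^esub> k')"
        using H'(1) K'(1) by (simp add: subset_iff M.a_ac)
      ultimately show ?thesis unfolding mem using H'(5) K'(5) by blast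
    qed
  qed
qed

lemma submodule_relative:
  assumes H: "submodule H R M" and K: "submodule K R M" and "H \<subseteq> K"
  shows "submodule H R (M\<lparr>carrier := K\<rparr>)"
proof -
  interpret MK: module R "M\<lparr>carrier := K\<rparr>"
    by (rule submodule.submodule_is_module[OF K module_axioms])
  have "M\<lparr>carrier := K\<rparr>\<lparr>carrier := H\<rparr> = M\<lparr>carrier := H\<rparr>" by simp
  then show ?thesis
    using MK.module_incl_imp_submodule[of H] \<open>H \<subseteq> K\<close>
      submodule.submodule_is_module[OF H module_axioms] by simp
qed

lemma submodule_INT:
  assumes "\<And>i. i \<in> I \<Longrightarrow> submodule (H i) R M" and "I \<noteq> {}"
  shows "submodule (\<Inter>i\<in>I. H i) R M"
proof (rule submoduleI)
  note sub = submoduleE[OF assms(1)] submodule_zero[OF assms(1)]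
  show "(\<Inter>i\<in>I. H i) \<subseteq> carrier M" using \<open>I \<noteq> {}\<close> sub(1) by blast
  show "\<zero>\<^bsub>M\<^esub> \<in> (\<Inter>i\<in>I. H i)" using sub(7) by blast
  show "\<ominus>\<^bsub>M\<^esub> a \<in> (\<Inter>i\<in>I. H i)" if "a \<in> (\<Inter>i\<in>I. H i)" for a using that sub(3) by blast
  show "a \<oplus>\<^bsub>M\<^esub> b \<in> (\<Inter>i\<in>I. H i)" if "a \<in> (\<Inter>i\<in>I. H i)" "b \<in> (\<Inter>i\<in>I. H i)" for a b
    using that sub(5) by blast
  show "r \<odot>\<^bsub>M\<^esub> x \<in> (\<Inter>i\<in>I. H i)" if "r \<in> carrier R" "x \<in> (\<Inter>i\<in>I. H i)" for r x
    using that sub(4) by blast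
qed

lemma submodule_elt_tors:
  assumes r: "r \<in> carrier R"
  shows "submodule (elt_tors M r) R M"
  using r unfolding elt_tors_def
  by (intro submoduleI) (auto simp: smult_r_minus smult_r_distr smult_left_commute[of r])

lemma elt_smult_submodule:
  assumes r: "r \<in> carrier R"
  shows "submodule (elt_smult M r) R M"
  unfolding elt_smult_def by (rule submodule_smult_image[OF r carrier_is_submodule])

lemma ideal_tors_PIdl:
  assumes r: "r \<in> carrier R"
  shows "ideal_tors M (PIdl\<^bsub>R\<^esub> r) = elt_tors M r"
  using r R.cgenideal_self[OF r] unfolding ideal_tors_def elt_tors_def cgenideal_def
  by (auto simp: smult_assoc1)

text \<open>For a principal ideal the products \<open>a x\<close> already form a submodule, so no sums are needed to describe
what they generate.\<close>

lemma ideal_smult_PIdl: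
  assumes r: "r \<in> carrier R" and H: "submodule H R M"
  shows "ideal_smult R M (PIdl\<^bsub>R\<^esub> r) H = (\<lambda>x. r \<odot>\<^bsub>M\<^esub> x) ` H"
proof -
  note H' = submoduleE[OF H]
  have "{a \<odot>\<^bsub>M\<^esub> x | a x. a \<in> PIdl\<^bsub>R\<^esub> r \<and> x \<in> H} = (\<lambda>x. r \<odot>\<^bsub>M\<^esub> x) ` H" (is "?S = _")
  proof
    show "?S \<subseteq> (\<lambda>x. r \<odot>\<^bsub>M\<^esub> x) ` H"
    proof
      fix y assume "y \<in> ?S"
      then obtain s x where sx: "s \<in> carrier R" "x \<in> H" "y = (s \<otimes> r) \<odot>\<^bsub>M\<^esub> x"
        unfolding cgenideal_def by blast
      then have "y = r \<odot>\<^bsub>M\<^esub> (s \<odot>\<^bsub>M\<^esub> x)"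
        using r H' smult_left_commute[of s r x] by (auto simp: smult_assoc1)
      then show "y \<in> (\<lambda>x. r \<odot>\<^bsub>M\<^esub> x) ` H" using sx H' by blast
    qed
    show "(\<lambda>x. r \<odot>\<^bsub>M\<^esub> x) ` H \<subseteq> ?S" using R.cgenideal_self[OF r] by blast
  qed
  then show ?thesis
    unfolding ideal_smult_def using gen_submodule_id[OF submodule_smult_image[OF r H]] by simp
qed

end

lemma a_r_coset_carrier_update [simp]:
  "a_r_coset (M\<lparr>carrier := K\<rparr>) H x = a_r_coset M H x"
  by (simp add: a_r_coset_def r_coset_def)

locale module_with_submodule = module R M for R (structure) and M (structure) and H +
  assumes submodule: "submodule H R M"

lemma (in module) module_with_submoduleI:
  "submodule H R M \<Longrightarrow> module_with_submodule R M H"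
  by (intro module_with_submodule.intro module_axioms module_with_submodule_axioms.intro)

sublocale module_with_submodule \<subseteq> S: abelian_subgroup H M
  by (rule submodule_imp_abelian_subgroup[OF submodule])

context module_with_submodule
begin

lemma carrier_quot: "carrier (quot_module M H) = {H +>\<^bsub>M\<^esub> x | x. x \<in> carrier M}"
  by (auto simp: quot_module_def A_RCOSETS_def')

lemma coset_in_quot: "x \<in> carrier M \<Longrightarrow> H +>\<^bsub>M\<^esub> x \<in> carrier (quot_module M H)"
  by (auto simp: carrier_quot)

lemma zero_quot: "\<zero>\<^bsub>quot_module M H\<^esub> = H"
  by (simp add: quot_module_def)

lemma add_quot:
  "\<lbrakk>x \<in> carrier M; y \<in> carrier M\<rbrakk> \<Longrightarrow>
   (H +>\<^bsub>M\<^esub> x) \<oplus>\<^bsub>quot_module M H\<^esub> (H +>\<^bsub>M\<^esub> y) = H +>\<^bsub>M\<^esub> (x \<oplus>\<^bsub>M\<^esub> y)"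
  by (simp add: quot_module_def S.a_rcos_sum)

lemma coset_zero: "H +>\<^bsub>M\<^esub> \<zero>\<^bsub>M\<^esub> = H"
  using S.a_subset by simp

lemma mem_coset_iff:
  assumes "x \<in> carrier M"
  shows "y \<in> H +>\<^bsub>M\<^esub> x \<longleftrightarrow> y \<in> carrier M \<and> y \<ominus>\<^bsub>M\<^esub> x \<in> H"
proof
  assume "y \<in> H +>\<^bsub>M\<^esub> x"
  then obtain h where h: "h \<in> H" "y = h \<oplus>\<^bsub>M\<^esub> x" unfolding a_r_coset_def' by blast
  then show "y \<in> carrier M \<and> y \<ominus>\<^bsub>M\<^esub> x \<in> H"
    using assms S.a_Hcarr[OF h(1)] by (simp add: a_minus_def M.a_assoc M.r_neg)
next
  assume y: "y \<in> carrier M \<and> y \<ominus>\<^bsub>M\<^esub> x \<in> H"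
  then have "y = (y \<ominus>\<^bsub>M\<^esub> x) \<oplus>\<^bsub>M\<^esub> x" using assms by (simp add: a_minus_def M.a_assoc M.l_neg)
  then show "y \<in> H +>\<^bsub>M\<^esub> x" using y unfolding a_r_coset_def' by blast
qed

lemma coset_eq_iff:
  assumes "x \<in> carrier M" "y \<in> carrier M"
  shows "H +>\<^bsub>M\<^esub> x = H +>\<^bsub>M\<^esub> y \<longleftrightarrow> x \<ominus>\<^bsub>M\<^esub> y \<in> H"
proof
  assume "H +>\<^bsub>M\<^esub> x = H +>\<^bsub>M\<^esub> y"
  then show "x \<ominus>\<^bsub>M\<^esub> y \<in> H" using S.a_rcos_self[OF assms(1)] mem_coset_iff[OF assms(2)] by simp
next
  assume "x \<ominus>\<^bsub>M\<^esub> y \<in> H"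
  then have "x \<in> H +>\<^bsub>M\<^esub> y" using assms mem_coset_iff by simp
  then show "H +>\<^bsub>M\<^esub> x = H +>\<^bsub>M\<^esub> y"
    using S.a_repr_independence'[OF _ assms(2)] by simp
qed

lemma coset_eq_self_iff:
  "x \<in> carrier M \<Longrightarrow> H +>\<^bsub>M\<^esub> x = H \<longleftrightarrow> x \<in> H"
  using coset_eq_iff[of x "\<zero>\<^bsub>M\<^esub>"] coset_zero M.minus_equality[of "\<zero>\<^bsub>M\<^esub>" "\<zero>\<^bsub>M\<^esub>"]
  by (simp add: a_minus_def)

lemma smult_quot:
  assumes r: "r \<in> carrier R" and x: "x \<in> carrier M"
  shows "r \<odot>\<^bsub>quot_module M H\<^esub> (H +>\<^bsub>M\<^esub> x) = H +>\<^bsub>M\<^esub> (r \<odot>\<^bsub>M\<^esub> x)"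
proof -
  note H' = submoduleE[OF submodule]
  have "y \<in> H <+>\<^bsub>M\<^esub> ((\<lambda>z. r \<odot>\<^bsub>M\<^esub> z) ` (H +>\<^bsub>M\<^esub> x)) \<longleftrightarrow> y \<in> H +>\<^bsub>M\<^esub> (r \<odot>\<^bsub>M\<^esub> x)" for y
  proof
    assume "y \<in> H <+>\<^bsub>M\<^esub> ((\<lambda>z. r \<odot>\<^bsub>M\<^esub> z) ` (H +>\<^bsub>M\<^esub> x))"
    then obtain h k where "h \<in> H" "k \<in> H" "y = h \<oplus>\<^bsub>M\<^esub> r \<odot>\<^bsub>M\<^esub> (k \<oplus>\<^bsub>M\<^esub> x)"
      unfolding set_add_def' a_r_coset_def' by blast
    moreover from this have "y = (h \<oplus>\<^bsub>M\<^esub> r \<odot>\<^bsub>M\<^esub> k) \<oplus>\<^bsub>M\<^esub> r \<odot>\<^bsub>M\<^esub> x"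
      using r x H'(1) by (simp add: subset_iff smult_r_distr M.a_assoc)
    ultimately show "y \<in> H +>\<^bsub>M\<^esub> (r \<odot>\<^bsub>M\<^esub> x)" unfolding a_r_coset_def' using H'(4,5) r by blast
  next
    assume "y \<in> H +>\<^bsub>M\<^esub> (r \<odot>\<^bsub>M\<^esub> x)"
    then obtain h where "h \<in> H" "y = h \<oplus>\<^bsub>M\<^esub> r \<odot>\<^bsub>M\<^esub> x" unfolding a_r_coset_def' by blast
    then show "y \<in> H <+>\<^bsub>M\<^esub> ((\<lambda>z. r \<odot>\<^bsub>M\<^esub> z) ` (H +>\<^bsub>M\<^esub> x))"
      unfolding set_add_def' using S.a_rcos_self[OF x] by blast
  qed
  then show ?thesis by (auto simp: quot_module_def)
qed

lemma quot_is_module: "module R (quot_module M H)"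
proof (rule moduleI)
  show "cring R" by (rule R.is_cring)
  show "abelian_group (quot_module M H)"
  proof (rule abelian_groupI)
    fix X assume "X \<in> carrier (quot_module M H)"
    then obtain x where x: "x \<in> carrier M" "X = H +>\<^bsub>M\<^esub> x" by (auto simp: carrier_quot)
    have "(H +>\<^bsub>M\<^esub> (\<ominus>\<^bsub>M\<^esub> x)) \<oplus>\<^bsub>quot_module M H\<^esub> X = \<zero>\<^bsub>quot_module M H\<^esub>"
      using x by (simp add: add_quot zero_quot M.l_neg coset_zero)
    then show "\<exists>Y\<in>carrier (quot_module M H). Y \<oplus>\<^bsub>quot_module M H\<^esub> X = \<zero>\<^bsub>quot_module M H\<^esub>"
      using x by (intro bexI[of _ "H +>\<^bsub>M\<^esub> (\<ominus>\<^bsub>M\<^esub> x)"] coset_in_quot) auto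
    show "\<zero>\<^bsub>quot_module M H\<^esub> \<oplus>\<^bsub>quot_module M H\<^esub> X = X"
      using x add_quot[of "\<zero>\<^bsub>M\<^esub>" x] by (simp add: zero_quot coset_zero)
  next
    show "\<zero>\<^bsub>quot_module M H\<^esub> \<in> carrier (quot_module M H)"
      using coset_in_quot[of "\<zero>\<^bsub>M\<^esub>"] by (simp add: zero_quot coset_zero)
  qed (auto simp: carrier_quot add_quot M.a_ac)
qed (auto simp: carrier_quot add_quot smult_quot smult_l_distr smult_r_distr smult_assoc1)

lemma finsum_quot:
  assumes "\<And>i. i \<in> A \<Longrightarrow> f i \<in> carrier M"
  shows "(\<Oplus>\<^bsub>quot_module M H\<^esub>i\<in>A. H +>\<^bsub>M\<^esub> f i) = H +>\<^bsub>M\<^esub> (\<Oplus>\<^bsub>M\<^esub>i\<in>A. f i)"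
proof -
  interpret Q: module R "quot_module M H" by (rule quot_is_module)
  show ?thesis using assms
  proof (induction A rule: infinite_finite_induct)
    case (insert a A)
    then have "f \<in> A \<rightarrow> carrier M"
      "(\<lambda>i. H +>\<^bsub>M\<^esub> f i) \<in> A \<rightarrow> carrier (quot_module M H)"
      using coset_in_quot by blast+
    then show ?case using insert by (simp add: coset_in_quot add_quot)
  qed (simp_all add: zero_quot coset_zero)
qed

end

section \<open>The filtration by upper levels\<close>

locale chain_module = chain_ring R p + module R M for R (structure) and p and M (structure)
begin

abbreviation pw :: "nat \<Rightarrow> 'c \<Rightarrow> 'c" where
  "pw k x \<equiv> (p [^] k) \<odot>\<^bsub>M\<^esub> x"

abbreviation tors :: "nat \<Rightarrow> 'c set" where
  "tors k \<equiv> elt_tors M (p [^] k)"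

text \<open>The submodule \<open>ur\<^sub>h(M) = \<Inter>\<^sub>i (M[\<mm>\<^sup>i] + \<mm>\<^sup>i\<^sup>-\<^sup>h\<^sup>+\<^sup>1 M)\<close>, which for \<open>h = 1\<close> is \<open>ur(M)\<close>. The truncated
subtraction gives \<open>\<mm>\<^sup>0 M = M\<close> when \<open>i < h\<close>, so only the indices \<open>i \<ge> h\<close> impose a condition.\<close>

definition ur_level :: "nat \<Rightarrow> 'c set" where
  "ur_level h = (\<Inter>i. tors i <+>\<^bsub>M\<^esub> elt_smult M (p [^] (i + 1 - h)))"

lemma pw_closed: "x \<in> carrier M \<Longrightarrow> pw k x \<in> carrier M"
  by simp

lemma pw_0: "x \<in> carrier M \<Longrightarrow> pw 0 x = x"
  by simp

lemma pw_pw: "x \<in> carrier M \<Longrightarrow> pw j (pw k x) = pw (j + k) x"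
  by (simp add: smult_assoc1[symmetric] nat_pow_mult)

lemma pw_p: "x \<in> carrier M \<Longrightarrow> pw k (p \<odot>\<^bsub>M\<^esub> x) = pw (Suc k) x"
  by (simp add: smult_assoc1)

lemma mem_tors: "x \<in> tors k \<longleftrightarrow> x \<in> carrier M \<and> pw k x = \<zero>\<^bsub>M\<^esub>"
  by (simp add: elt_tors_def)

lemma submodule_tors: "submodule (tors k) R M"
  by (rule submodule_elt_tors) simp

lemma tors_carrier: "x \<in> tors k \<Longrightarrow> x \<in> carrier M"
  by (simp add: mem_tors)

lemma pw_in_tors_iff: "x \<in> carrier M \<Longrightarrow> pw j x \<in> tors k \<longleftrightarrow> x \<in> tors (j + k)"
  by (simp add: mem_tors pw_pw add.commute)

lemma tors_mono:
  assumes "j \<le> k"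
  shows "tors j \<subseteq> tors k"
proof
  fix x assume x: "x \<in> tors j"
  then have "pw k x = pw (k - j) (pw j x)" using assms by (simp add: pw_pw tors_carrier)
  then show "x \<in> tors k" using x by (simp add: mem_tors)
qed

lemma tors_eventually_carrier: "\<exists>n. \<forall>k\<ge>n. tors k = carrier M"
proof -
  obtain n :: nat where n: "p [^] n = \<zero>" using uniformizer_nilpotent by blast
  then have "x \<in> tors n" if "x \<in> carrier M" for x using that n by (simp add: elt_tors_def)
  then have "tors n = carrier M" using tors_carrier by blast
  then have "tors k = carrier M" if "k \<ge> n" for k
    using tors_mono[OF that] tors_carrier by blast
  then show ?thesis by blast
qed

lemma submodule_ur_level: "submodule (ur_level h) R M"
  unfolding ur_level_def
  by (intro submodule_INT submodule_set_add submodule_tors elt_smult_submodule) auto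

lemma mem_ur_level:
  "x \<in> ur_level h \<longleftrightarrow> (\<forall>i. \<exists>a\<in>tors i. \<exists>b\<in>carrier M. x = a \<oplus>\<^bsub>M\<^esub> pw (i + 1 - h) b)"
  unfolding ur_level_def elt_smult_def set_add_def' by auto

text \<open>For \<open>i \<ge> h + t\<close> the element \<open>p\<^sup>t w\<close> is killed by \<open>p\<^sup>i\<close>; for smaller \<open>i\<close> it is divisible by
\<open>p\<^sup>i\<^sup>-\<^sup>h\<^sup>+\<^sup>1\<close>.\<close>

lemma pw_tors_in_ur_level:
  assumes w: "w \<in> tors (h + 2 * t)"
  shows "pw t w \<in> ur_level h"
  unfolding mem_ur_level
proof
  fix i
  note wc = tors_carrier[OF w]
  have "w \<in> tors (t + (h + t))" using w by (simp add: mult_2 add.left_commute)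
  then have "pw t w \<in> tors (h + t)" using pw_in_tors_iff[OF wc] by blast
  show "\<exists>a\<in>tors i. \<exists>b\<in>carrier M. pw t w = a \<oplus>\<^bsub>M\<^esub> pw (i + 1 - h) b"
  proof (cases "h + t \<le> i")
    case True
    then have "pw t w \<in> tors i" using \<open>pw t w \<in> tors (h + t)\<close> tors_mono by blast
    then show ?thesis
      using wc by (intro bexI[of _ "pw t w"] bexI[of _ "\<zero>\<^bsub>M\<^esub>"]) simp_all
  next
    case False
    then have "i + 1 - h \<le> t" by simp
    then have "pw t w = pw (i + 1 - h) (pw (t - (i + 1 - h)) w)"
      using wc by (simp add: pw_pw)
    then show ?thesis
      using wc submodule_zero[OF submodule_tors]
      by (intro bexI[of _ "\<zero>\<^bsub>M\<^esub>"] bexI[of _ "pw (t - (i + 1 - h)) w"]) simp_all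
  qed
qed

lemma ur_level_eventually_carrier: "\<exists>h\<ge>d. ur_level h = carrier M"
proof -
  obtain n where n: "\<And>k. k \<ge> n \<Longrightarrow> tors k = carrier M"
    using tors_eventually_carrier by blast
  have "ur_level (max d n) = carrier M"
    using pw_tors_in_ur_level[of _ "max d n" 0] submoduleE(1)[OF submodule_ur_level] n[of "max d n"]
    by auto
  then show ?thesis by (intro exI[of _ "max d n"]) simp
qed

text \<open>The summands are split off one at a time. The remainder \<open>p\<^sup>m y\<close> is again in \<open>ur\<^sub>h(M)\<close>, because the
terms already found are. Its condition for \<open>i = h + m\<close> reads \<open>p\<^sup>m y = a + p\<^sup>m\<^sup>+\<^sup>1 b\<close> with
\<open>a \<in> M[p\<^sup>h\<^sup>+\<^sup>m]\<close>, so that \<open>y - p b \<in> M[p\<^sup>h\<^sup>+\<^sup>2\<^sup>m]\<close> is the next coefficient and \<open>b\<close> the next remainder.\<close>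

lemma ur_level_expansion:
  assumes x: "x \<in> ur_level h" and h: "h \<ge> 1"
  shows "\<exists>w y. (\<forall>t<m. w t \<in> tors (h + 2 * t)) \<and> y \<in> carrier M \<and>
           x = (\<Oplus>\<^bsub>M\<^esub>t\<in>{..<m}. pw t (w t)) \<oplus>\<^bsub>M\<^esub> pw m y"
proof (induction m)
  case 0
  have "x \<in> carrier M" using x submoduleE(1)[OF submodule_ur_level] by blast
  then show ?case by (intro exI[of _ "\<lambda>_. \<zero>\<^bsub>M\<^esub>"] exI[of _ x]) simp
next
  case (Suc m)
  then obtain w y where w: "\<And>t. t < m \<Longrightarrow> w t \<in> tors (h + 2 * t)" and y: "y \<in> carrier M"
    and xw: "x = (\<Oplus>\<^bsub>M\<^esub>t\<in>{..<m}. pw t (w t)) \<oplus>\<^bsub>M\<^esub> pw m y" by blast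
  let ?s = "\<Oplus>\<^bsub>M\<^esub>t\<in>{..<m}. pw t (w t)"
  have s: "?s \<in> ur_level h"
    using w by (intro submodule_finsum[OF submodule_ur_level] pw_tors_in_ur_level) simp
  then have sc: "?s \<in> carrier M" using submoduleE(1)[OF submodule_ur_level] by blast
  have "x \<ominus>\<^bsub>M\<^esub> ?s = pw m y"
    unfolding xw using sc y by (simp add: a_minus_def M.a_assoc M.a_lcomm M.r_neg)
  then have "pw m y \<in> ur_level h"
    using submodule_minus[OF submodule_ur_level x s] by simp
  then obtain a b where a: "a \<in> tors (h + m)" and b: "b \<in> carrier M"
    and ab: "pw m y = a \<oplus>\<^bsub>M\<^esub> pw (h + m + 1 - h) b"
    unfolding mem_ur_level by blast
  note ac = tors_carrier[OF a]
  let ?v = "y \<ominus>\<^bsub>M\<^esub> p \<odot>\<^bsub>M\<^esub> b"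
  have vc: "?v \<in> carrier M" using y b by simp
  have "pw m ?v = pw m y \<ominus>\<^bsub>M\<^esub> pw (Suc m) b"
    using y b by (simp add: smult_minus_right pw_p del: nat_pow_Suc)
  also have "\<dots> = a" unfolding ab using ac b by (simp add: a_minus_def M.a_assoc M.r_neg)
  finally have va: "pw m ?v = a" .
  then have "?v \<in> tors (m + (h + m))" using a vc pw_in_tors_iff by metis
  then have v: "?v \<in> tors (h + 2 * m)" by (simp add: mult_2 add.left_commute)
  have wm: "w t \<in> carrier M" if "t < m" for t using w[OF that] by (rule tors_carrier)
  define w' where "w' = w(m := ?v)"
  have w': "w' t \<in> tors (h + 2 * t)" if "t < Suc m" for t
    using that w v unfolding w'_def by (cases "t = m") simp_all
  then have w'c: "w' t \<in> carrier M" if "t < Suc m" for t using that tors_carrier by blast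
  have "(\<Oplus>\<^bsub>M\<^esub>t\<in>{..<Suc m}. pw t (w' t)) = pw m (w' m) \<oplus>\<^bsub>M\<^esub> (\<Oplus>\<^bsub>M\<^esub>t\<in>{..<m}. pw t (w' t))"
    unfolding lessThan_Suc using w'c by (intro M.finsum_insert) auto
  moreover have "(\<Oplus>\<^bsub>M\<^esub>t\<in>{..<m}. pw t (w' t)) = ?s"
    using wm unfolding w'_def by (intro M.finsum_cong') auto
  ultimately have "(\<Oplus>\<^bsub>M\<^esub>t\<in>{..<Suc m}. pw t (w' t)) = pw m ?v \<oplus>\<^bsub>M\<^esub> ?s"
    by (simp add: w'_def)
  moreover have "pw m y = pw m ?v \<oplus>\<^bsub>M\<^esub> pw (Suc m) b"
    unfolding va using ab by (simp del: nat_pow_Suc)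
  ultimately have "x = (\<Oplus>\<^bsub>M\<^esub>t\<in>{..<Suc m}. pw t (w' t)) \<oplus>\<^bsub>M\<^esub> pw (Suc m) b"
    unfolding xw using sc vc b by (simp add: M.a_ac del: nat_pow_Suc)
  then show ?case using w' b by blast
qed

lemma ur_level_finite_expansion:
  assumes "x \<in> ur_level h" and "h \<ge> 1"
  shows "\<exists>n w. (\<forall>t<n. w t \<in> tors (h + 2 * t)) \<and> x = (\<Oplus>\<^bsub>M\<^esub>t\<in>{..<n}. pw t (w t))"
proof -
  obtain n where n: "tors n = carrier M" using tors_eventually_carrier by blast
  obtain w y where w: "\<forall>t<n. w t \<in> tors (h + 2 * t)" and y: "y \<in> carrier M"
    and xw: "x = (\<Oplus>\<^bsub>M\<^esub>t\<in>{..<n}. pw t (w t)) \<oplus>\<^bsub>M\<^esub> pw n y"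
    using ur_level_expansion[OF assms, of n] by blast
  have "pw n y = \<zero>\<^bsub>M\<^esub>" using y n mem_tors by blast
  moreover have "(\<Oplus>\<^bsub>M\<^esub>t\<in>{..<n}. pw t (w t)) \<in> carrier M"
    using w tors_carrier by (intro M.finsum_closed) auto
  ultimately show ?thesis using w xw by auto
qed

text \<open>The descent criterion: \<open>p\<^sup>t w\<^sub>t = p\<^sup>t u + p\<^sup>t\<^sup>+\<^sup>1 u'\<close> is a sum of two terms of the shape
\<open>p\<^sup>s M[p\<^sup>h\<^sup>-\<^sup>1\<^sup>+\<^sup>2\<^sup>s]\<close>, for \<open>s = t\<close> and \<open>s = t + 1\<close>.\<close>

lemma ur_level_step:
  assumes x: "x = (\<Oplus>\<^bsub>M\<^esub>t\<in>{..<n}. pw t (w t))" and h: "h \<ge> 1"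
    and split: "\<And>t. t < n \<Longrightarrow> \<exists>u\<in>tors (h - 1 + 2 * t). \<exists>u'\<in>tors (h + 1 + 2 * t). w t = u \<oplus>\<^bsub>M\<^esub> p \<odot>\<^bsub>M\<^esub> u'"
  shows "x \<in> ur_level (h - 1)"
  unfolding x
proof (rule submodule_finsum[OF submodule_ur_level])
  fix t assume "t \<in> {..<n}"
  then obtain u u' where u: "u \<in> tors (h - 1 + 2 * t)" and u': "u' \<in> tors (h + 1 + 2 * t)"
    and w: "w t = u \<oplus>\<^bsub>M\<^esub> p \<odot>\<^bsub>M\<^esub> u'" using split by blast
  have "h + 1 + 2 * t = h - 1 + 2 * Suc t" using h by simp
  then have "pw (Suc t) u' \<in> ur_level (h - 1)" using u' pw_tors_in_ur_level by metis
  moreover have "pw t u \<in> ur_level (h - 1)" using u by (rule pw_tors_in_ur_level)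
  moreover have "pw t (w t) = pw t u \<oplus>\<^bsub>M\<^esub> pw (Suc t) u'"
    unfolding w using tors_carrier[OF u] tors_carrier[OF u']
    by (simp add: smult_r_distr pw_p del: nat_pow_Suc)
  ultimately show "pw t (w t) \<in> ur_level (h - 1)"
    using submoduleE(5)[OF submodule_ur_level] by simp
qed

end

section \<open>Extension of functionals\<close>

definition linear_on ::
  "('a, 'r) ring_scheme \<Rightarrow> ('a, 'b, 'm) module_scheme \<Rightarrow> ('a, 'c, 'n) module_scheme \<Rightarrow>
   'b set \<Rightarrow> ('b \<Rightarrow> 'c) \<Rightarrow> bool" where
  "linear_on R M N H f \<longleftrightarrow>
     (\<forall>x\<in>H. f x \<in> carrier N) \<and>
     (\<forall>x\<in>H. \<forall>y\<in>H. f (x \<oplus>\<^bsub>M\<^esub> y) = f x \<oplus>\<^bsub>N\<^esub> f y) \<and>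
     (\<forall>r\<in>carrier R. \<forall>x\<in>H. f (r \<odot>\<^bsub>M\<^esub> x) = r \<odot>\<^bsub>N\<^esub> f x)"

lemma (in module) submodule_cyclic:
  assumes g: "g \<in> carrier M"
  shows "submodule ((\<lambda>r. r \<odot>\<^bsub>M\<^esub> g) ` carrier R) R M"
proof (rule submoduleI)
  let ?C = "(\<lambda>r. r \<odot>\<^bsub>M\<^esub> g) ` carrier R"
  show "?C \<subseteq> carrier M" using g by blast
  show "\<zero>\<^bsub>M\<^esub> \<in> ?C" using g by (intro image_eqI[of _ _ "\<zero>\<^bsub>R\<^esub>"]) simp_all
  show "\<ominus>\<^bsub>M\<^esub> a \<in> ?C" if a: "a \<in> ?C" for a
  proof -
    obtain r where "r \<in> carrier R" "a = r \<odot>\<^bsub>M\<^esub> g" using a by blast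
    then show ?thesis using g by (intro image_eqI[of _ _ "\<ominus>\<^bsub>R\<^esub> r"]) (simp_all add: smult_l_minus)
  qed
  show "a \<oplus>\<^bsub>M\<^esub> b \<in> ?C" if ab: "a \<in> ?C" "b \<in> ?C" for a b
  proof -
    obtain r s where "r \<in> carrier R" "a = r \<odot>\<^bsub>M\<^esub> g" "s \<in> carrier R" "b = s \<odot>\<^bsub>M\<^esub> g" using ab by blast
    then show ?thesis using g by (intro image_eqI[of _ _ "r \<oplus>\<^bsub>R\<^esub> s"]) (simp_all add: smult_l_distr)
  qed
  show "s \<odot>\<^bsub>M\<^esub> a \<in> ?C" if s: "s \<in> carrier R" and a: "a \<in> ?C" for s a
  proof -
    obtain r where "r \<in> carrier R" "a = r \<odot>\<^bsub>M\<^esub> g" using a by blast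
    then show ?thesis using g s by (intro image_eqI[of _ _ "s \<otimes>\<^bsub>R\<^esub> r"]) (simp_all add: smult_assoc1)
  qed
qed

locale module_pair = M: module R M + N: module R N
  for R (structure) and M (structure) and N (structure)
begin

lemma linear_on_zero_minus:
  assumes f: "linear_on R M N H f" and H: "submodule H R M"
  shows "f \<zero>\<^bsub>M\<^esub> = \<zero>\<^bsub>N\<^esub>" and "x \<in> H \<Longrightarrow> f (\<ominus>\<^bsub>M\<^esub> x) = \<ominus>\<^bsub>N\<^esub> f x"
proof -
  have z: "\<zero>\<^bsub>M\<^esub> \<in> H" by (rule M.submodule_zero[OF H])
  then have "f (\<zero>\<^bsub>R\<^esub> \<odot>\<^bsub>M\<^esub> \<zero>\<^bsub>M\<^esub>) = \<zero>\<^bsub>R\<^esub> \<odot>\<^bsub>N\<^esub> f \<zero>\<^bsub>M\<^esub>"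
    using f unfolding linear_on_def by blast
  then show f0: "f \<zero>\<^bsub>M\<^esub> = \<zero>\<^bsub>N\<^esub>" using z f unfolding linear_on_def by simp
  assume x: "x \<in> H"
  have nx: "\<ominus>\<^bsub>M\<^esub> x \<in> H" and xc: "x \<in> carrier M" using M.submoduleE(1,3)[OF H] x by blast+
  have "f (\<ominus>\<^bsub>M\<^esub> x) \<oplus>\<^bsub>N\<^esub> f x = f (\<ominus>\<^bsub>M\<^esub> x \<oplus>\<^bsub>M\<^esub> x)"
    using f x nx unfolding linear_on_def by simp
  also have "\<dots> = \<zero>\<^bsub>N\<^esub>" using xc f0 by (simp add: M.M.l_neg)
  finally show "f (\<ominus>\<^bsub>M\<^esub> x) = \<ominus>\<^bsub>N\<^esub> f x"
    using f x nx N.M.minus_equality unfolding linear_on_def by metis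
qed

text \<open>The extension to \<open>H + R g\<close> is \<open>h + r g \<mapsto> f h + r e\<close>. The hypothesis \<open>compat\<close> is exactly what makes it
independent of the choice of \<open>h\<close> and \<open>r\<close>.\<close>

lemma linear_extension_by_element:
  assumes f: "linear_on R M N H f" and H: "submodule H R M"
    and g: "g \<in> carrier M" and e: "e \<in> carrier N"
    and compat: "\<And>r. \<lbrakk>r \<in> carrier R; r \<odot>\<^bsub>M\<^esub> g \<in> H\<rbrakk> \<Longrightarrow> f (r \<odot>\<^bsub>M\<^esub> g) = r \<odot>\<^bsub>N\<^esub> e"
  shows "\<exists>K F. submodule K R M \<and> H \<subseteq> K \<and> g \<in> K \<and> linear_on R M N K F \<and>
               (\<forall>x\<in>H. F x = f x) \<and> F g = e"
proof -
  define K where "K = H <+>\<^bsub>M\<^esub> ((\<lambda>r. r \<odot>\<^bsub>M\<^esub> g) ` carrier R)"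
  define F where
    "F x = (SOME y. \<exists>h\<in>H. \<exists>r\<in>carrier R. x = h \<oplus>\<^bsub>M\<^esub> r \<odot>\<^bsub>M\<^esub> g \<and> y = f h \<oplus>\<^bsub>N\<^esub> r \<odot>\<^bsub>N\<^esub> e)" for x
  note Hc = subsetD[OF M.submoduleE(1)[OF H]] and Hadd = M.submoduleE(5)[OF H]
    and Hsm = M.submoduleE(4)[OF H] and Hneg = M.submoduleE(3)[OF H]
  have fc: "f x \<in> carrier N" if "x \<in> H" for x using f that unfolding linear_on_def by blast
  have fadd: "f (x \<oplus>\<^bsub>M\<^esub> y) = f x \<oplus>\<^bsub>N\<^esub> f y" if "x \<in> H" "y \<in> H" for x y
    using f that unfolding linear_on_def by blast
  have fsm: "f (r \<odot>\<^bsub>M\<^esub> x) = r \<odot>\<^bsub>N\<^esub> f x" if "r \<in> carrier R" "x \<in> H" for r x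
    using f that unfolding linear_on_def by blast
  note fneg = linear_on_zero_minus(2)[OF f H]
  have memK: "x \<in> K \<longleftrightarrow> (\<exists>h\<in>H. \<exists>r\<in>carrier R. x = h \<oplus>\<^bsub>M\<^esub> r \<odot>\<^bsub>M\<^esub> g)" for x
    unfolding K_def set_add_def' by blast
  have K: "submodule K R M"
    unfolding K_def by (rule M.submodule_set_add[OF H M.submodule_cyclic[OF g]])
  \<comment> \<open>Two representations differ by an element of \<open>H\<close> that is a multiple of \<open>g\<close>.\<close>
  have wd: "f h \<oplus>\<^bsub>N\<^esub> r \<odot>\<^bsub>N\<^esub> e = f h' \<oplus>\<^bsub>N\<^esub> r' \<odot>\<^bsub>N\<^esub> e"
    if h: "h \<in> H" "h' \<in> H" and r: "r \<in> carrier R" "r' \<in> carrier R"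
      and eq: "h \<oplus>\<^bsub>M\<^esub> r \<odot>\<^bsub>M\<^esub> g = h' \<oplus>\<^bsub>M\<^esub> r' \<odot>\<^bsub>M\<^esub> g" for h h' r r'
  proof -
    let ?d = "\<ominus>\<^bsub>M\<^esub> h' \<oplus>\<^bsub>M\<^esub> h"
    have d: "?d \<in> H" using h Hadd Hneg by blast
    have "\<ominus>\<^bsub>M\<^esub> h' \<oplus>\<^bsub>M\<^esub> (h \<oplus>\<^bsub>M\<^esub> r \<odot>\<^bsub>M\<^esub> g) = r' \<odot>\<^bsub>M\<^esub> g"
      unfolding eq using h r g Hc by (simp add: M.M.r_neg1)
    then have eq': "?d \<oplus>\<^bsub>M\<^esub> r \<odot>\<^bsub>M\<^esub> g = r' \<odot>\<^bsub>M\<^esub> g"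
      using h r g Hc by (simp add: M.M.a_assoc)
    have "(r' \<ominus> r) \<odot>\<^bsub>M\<^esub> g = r' \<odot>\<^bsub>M\<^esub> g \<oplus>\<^bsub>M\<^esub> \<ominus>\<^bsub>M\<^esub> (r \<odot>\<^bsub>M\<^esub> g)"
      using r g by (simp add: a_minus_def M.smult_l_distr M.smult_l_minus)
    also have "\<dots> = ?d" unfolding eq'[symmetric] using d r g Hc by (simp add: M.M.a_assoc M.M.r_neg)
    finally have "f ?d = (r' \<ominus> r) \<odot>\<^bsub>N\<^esub> e" using compat[of "r' \<ominus> r"] r d by simp
    then have "\<ominus>\<^bsub>N\<^esub> f h' \<oplus>\<^bsub>N\<^esub> f h = r' \<odot>\<^bsub>N\<^esub> e \<oplus>\<^bsub>N\<^esub> \<ominus>\<^bsub>N\<^esub> (r \<odot>\<^bsub>N\<^esub> e)"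
      using r e h Hneg fadd fneg by (simp add: a_minus_def N.smult_l_distr N.smult_l_minus)
    then have "f h' \<oplus>\<^bsub>N\<^esub> (\<ominus>\<^bsub>N\<^esub> f h' \<oplus>\<^bsub>N\<^esub> f h) \<oplus>\<^bsub>N\<^esub> r \<odot>\<^bsub>N\<^esub> e =
        f h' \<oplus>\<^bsub>N\<^esub> (r' \<odot>\<^bsub>N\<^esub> e \<oplus>\<^bsub>N\<^esub> \<ominus>\<^bsub>N\<^esub> (r \<odot>\<^bsub>N\<^esub> e)) \<oplus>\<^bsub>N\<^esub> r \<odot>\<^bsub>N\<^esub> e"
      by simp
    then show ?thesis using r e h fc by (simp add: N.M.r_neg2 N.M.a_assoc N.M.l_neg)
  qed
  have F: "F (h \<oplus>\<^bsub>M\<^esub> r \<odot>\<^bsub>M\<^esub> g) = f h \<oplus>\<^bsub>N\<^esub> r \<odot>\<^bsub>N\<^esub> e" if "h \<in> H" "r \<in> carrier R" for h r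
    unfolding F_def
  proof (rule some_equality)
    show "\<exists>h'\<in>H. \<exists>r'\<in>carrier R. h \<oplus>\<^bsub>M\<^esub> r \<odot>\<^bsub>M\<^esub> g = h' \<oplus>\<^bsub>M\<^esub> r' \<odot>\<^bsub>M\<^esub> g \<and>
        f h \<oplus>\<^bsub>N\<^esub> r \<odot>\<^bsub>N\<^esub> e = f h' \<oplus>\<^bsub>N\<^esub> r' \<odot>\<^bsub>N\<^esub> e"
      using that by blast
    fix y
    assume "\<exists>h'\<in>H. \<exists>r'\<in>carrier R. h \<oplus>\<^bsub>M\<^esub> r \<odot>\<^bsub>M\<^esub> g = h' \<oplus>\<^bsub>M\<^esub> r' \<odot>\<^bsub>M\<^esub> g \<and>
        y = f h' \<oplus>\<^bsub>N\<^esub> r' \<odot>\<^bsub>N\<^esub> e"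
    then obtain h' r' where "h' \<in> H" "r' \<in> carrier R"
      "h \<oplus>\<^bsub>M\<^esub> r \<odot>\<^bsub>M\<^esub> g = h' \<oplus>\<^bsub>M\<^esub> r' \<odot>\<^bsub>M\<^esub> g" "y = f h' \<oplus>\<^bsub>N\<^esub> r' \<odot>\<^bsub>N\<^esub> e"
      by blast
    then show "y = f h \<oplus>\<^bsub>N\<^esub> r \<odot>\<^bsub>N\<^esub> e" using wd[of h h' r r'] that by simp
  qed
  have "linear_on R M N K F"
    unfolding linear_on_def
  proof (intro conjI ballI)
    fix x assume "x \<in> K"
    then obtain h r where x: "h \<in> H" "r \<in> carrier R" "x = h \<oplus>\<^bsub>M\<^esub> r \<odot>\<^bsub>M\<^esub> g" unfolding memK by blast
    then show "F x \<in> carrier N" using F fc e by simp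
    fix y assume "y \<in> K"
    then obtain h' r' where y: "h' \<in> H" "r' \<in> carrier R" "y = h' \<oplus>\<^bsub>M\<^esub> r' \<odot>\<^bsub>M\<^esub> g" unfolding memK by blast
    have "x \<oplus>\<^bsub>M\<^esub> y = (h \<oplus>\<^bsub>M\<^esub> h') \<oplus>\<^bsub>M\<^esub> (r \<oplus> r') \<odot>\<^bsub>M\<^esub> g"
      using x y g Hc by (simp add: M.smult_l_distr M.M.a_ac)
    then have "F (x \<oplus>\<^bsub>M\<^esub> y) = f (h \<oplus>\<^bsub>M\<^esub> h') \<oplus>\<^bsub>N\<^esub> (r \<oplus> r') \<odot>\<^bsub>N\<^esub> e"
      using F x y Hadd by simp
    also have "\<dots> = F x \<oplus>\<^bsub>N\<^esub> F y"
      using x y e fc fadd F by (simp add: N.smult_l_distr N.M.a_ac)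
    finally show "F (x \<oplus>\<^bsub>M\<^esub> y) = F x \<oplus>\<^bsub>N\<^esub> F y" .
  next
    fix s x assume s: "s \<in> carrier R" and "x \<in> K"
    then obtain h r where x: "h \<in> H" "r \<in> carrier R" "x = h \<oplus>\<^bsub>M\<^esub> r \<odot>\<^bsub>M\<^esub> g" unfolding memK by blast
    have "s \<odot>\<^bsub>M\<^esub> x = s \<odot>\<^bsub>M\<^esub> h \<oplus>\<^bsub>M\<^esub> (s \<otimes> r) \<odot>\<^bsub>M\<^esub> g"
      using x s g Hc by (simp add: M.smult_r_distr M.smult_assoc1)
    then have "F (s \<odot>\<^bsub>M\<^esub> x) = f (s \<odot>\<^bsub>M\<^esub> h) \<oplus>\<^bsub>N\<^esub> (s \<otimes> r) \<odot>\<^bsub>N\<^esub> e"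
      using F x s Hsm by simp
    also have "\<dots> = s \<odot>\<^bsub>N\<^esub> F x"
      using x s e fc fsm F by (simp add: N.smult_r_distr N.smult_assoc1)
    finally show "F (s \<odot>\<^bsub>M\<^esub> x) = s \<odot>\<^bsub>N\<^esub> F x" .
  qed
  moreover have Fh: "F h = f h" if "h \<in> H" for h
    using F[OF that, of \<zero>] that g e fc Hc by simp
  moreover have "H \<subseteq> K"
  proof
    fix h assume h: "h \<in> H"
    then have "h = h \<oplus>\<^bsub>M\<^esub> \<zero> \<odot>\<^bsub>M\<^esub> g" using g Hc by simp
    then show "h \<in> K" unfolding memK using h by blast
  qed
  moreover have "\<zero>\<^bsub>M\<^esub> \<oplus>\<^bsub>M\<^esub> \<one> \<odot>\<^bsub>M\<^esub> g = g" using g by simp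
  then have "g \<in> K" unfolding memK using M.submodule_zero[OF H] by (metis M.R.one_closed)
  moreover have "F g = e"
    using F[OF M.submodule_zero[OF H] M.R.one_closed] g e linear_on_zero_minus(1)[OF f H] by simp
  ultimately show ?thesis using K by blast
qed

end

text \<open>The ideal \<open>{r. r g \<in> H}\<close> is generated by the least power of \<open>p\<close> in it, since units can be cancelled.\<close>

lemma (in chain_module) conductor_principal:
  assumes H: "submodule H R M" and g: "g \<in> carrier M"
  shows "\<exists>k. pw k g \<in> H \<and> (\<forall>r\<in>carrier R. r \<odot>\<^bsub>M\<^esub> g \<in> H \<longrightarrow> (\<exists>s\<in>carrier R. r = s \<otimes> p [^] k))"
proof -
  define k where "k = (LEAST k. pw k g \<in> H)"
  obtain n :: nat where "p [^] n = \<zero>" using uniformizer_nilpotent by blast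
  then have "pw n g \<in> H" using g submodule_zero[OF H] by simp
  then have k: "pw k g \<in> H" unfolding k_def by (rule LeastI)
  have "\<exists>s\<in>carrier R. r = s \<otimes> p [^] k" if r: "r \<in> carrier R" "r \<odot>\<^bsub>M\<^esub> g \<in> H" for r
  proof -
    obtain u j where u: "u \<in> Units R" and uj: "r = u \<otimes> p [^] (j::nat)"
      using unit_times_power[OF r(1)] by blast
    note uc = Units_closed[OF u]
    have "inv u \<otimes> r = p [^] j" unfolding uj using u uc by (simp add: m_assoc[symmetric])
    then have "inv u \<odot>\<^bsub>M\<^esub> (r \<odot>\<^bsub>M\<^esub> g) = pw j g"
      using smult_assoc1[OF Units_inv_closed[OF u] r(1) g] by simp
    then have "pw j g \<in> H" using submoduleE(4)[OF H Units_inv_closed[OF u] r(2)] by simp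
    then have "k \<le> j" unfolding k_def by (rule Least_le)
    then have "r = (u \<otimes> p [^] (j - k)) \<otimes> p [^] k"
      unfolding uj using uc by (simp add: m_assoc nat_pow_mult)
    then show ?thesis using uc by blast
  qed
  then show ?thesis using k by blast
qed

text \<open>Two properties of the ring as a module over itself, carried over to a module isomorphic to it.\<close>

lemma rank_one_free_module:
  fixes R (structure) and N (structure)
  assumes chain: "chain_ring R p" and N: "module R N" and iso: "mod_iso R N (ring_as_module R) \<noteq> {}"
  shows dvd_power_if_annihilated_module:
      "\<And>c k. \<lbrakk>c \<in> carrier N; \<And>j::nat. p [^]\<^bsub>R\<^esub> (j + k) = \<zero>\<^bsub>R\<^esub> \<Longrightarrow> (p [^]\<^bsub>R\<^esub> j) \<odot>\<^bsub>N\<^esub> c = \<zero>\<^bsub>N\<^esub>\<rbrakk> \<Longrightarrow>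
         \<exists>e\<in>carrier N. c = (p [^]\<^bsub>R\<^esub> k) \<odot>\<^bsub>N\<^esub> e"
    and exists_socle_element_module:
      "\<exists>c\<in>carrier N. c \<noteq> \<zero>\<^bsub>N\<^esub> \<and> p \<odot>\<^bsub>N\<^esub> c = \<zero>\<^bsub>N\<^esub>"
proof -
  interpret chain_ring R p by fact
  interpret N: module R N by fact
  obtain \<phi> where bij: "bij_betw \<phi> (carrier N) (carrier R)"
    and sm: "\<And>r x. \<lbrakk>r \<in> carrier R; x \<in> carrier N\<rbrakk> \<Longrightarrow> \<phi> (r \<odot>\<^bsub>N\<^esub> x) = r \<otimes>\<^bsub>R\<^esub> \<phi> x"
    using iso unfolding mod_iso_def mod_hom_def ring_as_module_def by auto
  have c: "\<phi> x \<in> carrier R" if "x \<in> carrier N" for x using bij that by (auto simp: bij_betw_def)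
  have inj: "x = y" if "x \<in> carrier N" "y \<in> carrier N" "\<phi> x = \<phi> y" for x y
    using bij that by (auto simp: bij_betw_def inj_on_def)
  have surj: "\<exists>x\<in>carrier N. r = \<phi> x" if "r \<in> carrier R" for r
    using bij that by (auto simp: bij_betw_def)
  have zero: "\<phi> \<zero>\<^bsub>N\<^esub> = \<zero>\<^bsub>R\<^esub>" using sm[of "\<zero>\<^bsub>R\<^esub>" "\<zero>\<^bsub>N\<^esub>"] c by simp
  show "\<exists>e\<in>carrier N. x = (p [^]\<^bsub>R\<^esub> k) \<odot>\<^bsub>N\<^esub> e"
    if x: "x \<in> carrier N" and ann: "\<And>j::nat. p [^]\<^bsub>R\<^esub> (j + k) = \<zero>\<^bsub>R\<^esub> \<Longrightarrow> (p [^]\<^bsub>R\<^esub> j) \<odot>\<^bsub>N\<^esub> x = \<zero>\<^bsub>N\<^esub>"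
    for x k
  proof -
    have "\<exists>e\<in>carrier R. \<phi> x = p [^]\<^bsub>R\<^esub> k \<otimes>\<^bsub>R\<^esub> e"
      using ann sm[OF power_closed x] zero c[OF x] by (intro dvd_power_if_annihilated) metis+
    then obtain e where e: "e \<in> carrier N" "\<phi> x = p [^]\<^bsub>R\<^esub> k \<otimes>\<^bsub>R\<^esub> \<phi> e" using surj by metis
    then have "x = (p [^]\<^bsub>R\<^esub> k) \<odot>\<^bsub>N\<^esub> e" using inj x sm by simp
    then show ?thesis using e by blast
  qed
  obtain r where r: "r \<in> carrier R" "r \<noteq> \<zero>\<^bsub>R\<^esub>" "p \<otimes>\<^bsub>R\<^esub> r = \<zero>\<^bsub>R\<^esub>" using exists_socle_element by blast
  then obtain x where x: "x \<in> carrier N" "r = \<phi> x" using surj by blast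
  then have "p \<odot>\<^bsub>N\<^esub> x = \<zero>\<^bsub>N\<^esub>" using inj sm r zero by simp
  then show "\<exists>c\<in>carrier N. c \<noteq> \<zero>\<^bsub>N\<^esub> \<and> p \<odot>\<^bsub>N\<^esub> c = \<zero>\<^bsub>N\<^esub>" using x r zero by (intro bexI[of _ x]) auto
qed

locale chain_form = chain_ring R p + symmetric_bilinear_form R M N B
  for R (structure) and p and M (structure) and N (structure) and B

sublocale chain_form \<subseteq> M: chain_module R p M ..
sublocale chain_form \<subseteq> N: chain_module R p N ..
sublocale chain_form \<subseteq> module_pair R M N ..

context chain_form
begin

text \<open>To add one element \<open>g\<close>, let \<open>p\<^sup>k\<close> generate \<open>{r. r g \<in> K}\<close>. The image of \<open>g\<close> must be some \<open>e\<close> with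
\<open>p\<^sup>k e = F (p\<^sup>k g)\<close>; it exists since whatever kills \<open>p\<^sup>k\<close> also kills \<open>F (p\<^sup>k g)\<close>.\<close>

lemma linear_extension_finite:
  assumes iso: "mod_iso R N (ring_as_module R) \<noteq> {}"
    and f: "linear_on R M N H f" and H: "submodule H R M"
    and S: "finite S" "S \<subseteq> carrier M"
  shows "\<exists>K F. submodule K R M \<and> H \<subseteq> K \<and> S \<subseteq> K \<and> linear_on R M N K F \<and> (\<forall>x\<in>H. F x = f x)"
  using S
proof (induction S rule: finite_induct)
  case empty
  then show ?case using f H by blast
next
  case (insert g S)
  then obtain K F where K: "submodule K R M" and sub: "H \<subseteq> K" "S \<subseteq> K"
    and F: "linear_on R M N K F" and ext: "\<forall>x\<in>H. F x = f x" by auto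
  have g: "g \<in> carrier M" using insert by simp
  obtain k where k: "M.pw k g \<in> K"
    and cond: "\<And>r. \<lbrakk>r \<in> carrier R; r \<odot>\<^bsub>M\<^esub> g \<in> K\<rbrakk> \<Longrightarrow> \<exists>s\<in>carrier R. r = s \<otimes> p [^] k"
    using M.conductor_principal[OF K g] by blast
  have Fsm: "F (r \<odot>\<^bsub>M\<^esub> x) = r \<odot>\<^bsub>N\<^esub> F x" if "r \<in> carrier R" "x \<in> K" for r x
    using F that unfolding linear_on_def by blast
  have Fk: "F (M.pw k g) \<in> carrier N" using F k unfolding linear_on_def by blast
  have "\<exists>e\<in>carrier N. F (M.pw k g) = N.pw k e"
  proof (rule dvd_power_if_annihilated_module[OF chain_ring_axioms N.module_axioms iso Fk])
    fix j :: nat assume "p [^] (j + k) = \<zero>"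
    then have "M.pw j (M.pw k g) = \<zero>\<^bsub>M\<^esub>" using M.pw_pw[OF g] g by simp
    then show "N.pw j (F (M.pw k g)) = \<zero>\<^bsub>N\<^esub>"
      using Fsm[OF power_closed k] linear_on_zero_minus(1)[OF F K] by metis
  qed
  then obtain e where e: "e \<in> carrier N" "F (M.pw k g) = N.pw k e" by blast
  have "F (r \<odot>\<^bsub>M\<^esub> g) = r \<odot>\<^bsub>N\<^esub> e" if r: "r \<in> carrier R" "r \<odot>\<^bsub>M\<^esub> g \<in> K" for r
  proof -
    obtain s where s: "s \<in> carrier R" "r = s \<otimes> p [^] k" using cond[OF r] by blast
    then have "F (r \<odot>\<^bsub>M\<^esub> g) = s \<odot>\<^bsub>N\<^esub> F (M.pw k g)" using Fsm[OF s(1) k] g by (simp add: M.smult_assoc1)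
    then show ?thesis using s e by (simp add: N.smult_assoc1)
  qed
  from linear_extension_by_element[OF F K g e(1) this] obtain K' F' where
    "submodule K' R M" "K \<subseteq> K'" "g \<in> K'" "linear_on R M N K' F'" "\<forall>x\<in>K. F' x = F x" by blast
  then show ?case using sub ext by (intro exI[of _ K'] exI[of _ F']) auto
qed

text \<open>This is the inclusion \<open>L\<^sup>\<bottom>\<^sup>\<bottom> \<subseteq> L\<close>. A functional on \<open>L + R a\<close> that vanishes on \<open>L\<close> and sends \<open>a\<close> to a nonzero
element of \<open>N[p]\<close> is well defined because the elements \<open>r\<close> with \<open>r a \<in> L\<close> are multiples of \<open>p\<close>. Its
extension to \<open>M\<close> is represented by an element of \<open>M\<close>.\<close>

lemma nondegenerate_separates:
  assumes iso: "mod_iso R N (ring_as_module R) \<noteq> {}" and fg: "fin_gen_module R M"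
    and nondeg: "nondegenerate R M N B"
    and L: "submodule L R M" and a: "a \<in> carrier M" "a \<notin> L"
  shows "\<exists>x\<in>perp M N B L. B x a \<noteq> \<zero>\<^bsub>N\<^esub>"
proof -
  obtain k where k: "M.pw k a \<in> L"
    and cond: "\<And>r. \<lbrakk>r \<in> carrier R; r \<odot>\<^bsub>M\<^esub> a \<in> L\<rbrakk> \<Longrightarrow> \<exists>s\<in>carrier R. r = s \<otimes> p [^] k"
    using M.conductor_principal[OF L a(1)] by blast
  have "k \<noteq> 0" using k a by (metis M.pw_0)
  then obtain k' where k': "k = Suc k'" by (cases k) auto
  obtain c where c: "c \<in> carrier N" "c \<noteq> \<zero>\<^bsub>N\<^esub>" "p \<odot>\<^bsub>N\<^esub> c = \<zero>\<^bsub>N\<^esub>"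
    using exists_socle_element_module[OF chain_ring_axioms N.module_axioms iso] by blast
  have L0: "linear_on R M N L (\<lambda>_. \<zero>\<^bsub>N\<^esub>)" unfolding linear_on_def by simp
  have "\<zero>\<^bsub>N\<^esub> = r \<odot>\<^bsub>N\<^esub> c" if r: "r \<in> carrier R" "r \<odot>\<^bsub>M\<^esub> a \<in> L" for r
  proof -
    obtain s where s: "s \<in> carrier R" "r = s \<otimes> p [^] k" using cond[OF r] by blast
    then have "r = (s \<otimes> p [^] k') \<otimes> p" unfolding k' by (simp add: m_assoc)
    then show ?thesis using s c by (simp add: N.smult_assoc1)
  qed
  from linear_extension_by_element[OF L0 L a(1) c(1) this] obtain K F where
    K: "submodule K R M" "L \<subseteq> K" "a \<in> K" and F: "linear_on R M N K F" "\<forall>x\<in>L. F x = \<zero>\<^bsub>N\<^esub>" "F a = c"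
    by blast
  obtain S where S: "finite S" "S \<subseteq> carrier M" "gen_submodule R M S = carrier M"
    using fg unfolding fin_gen_module_def by blast
  obtain K' F' where K': "submodule K' R M" "K \<subseteq> K'" "S \<subseteq> K'"
    and F': "linear_on R M N K' F'" "\<forall>x\<in>K. F' x = F x"
    using linear_extension_finite[OF iso F(1) K(1) S(1,2)] by blast
  have "K' = carrier M"
    using M.gen_submodule_minimal[OF K'(1,3)] S(3) M.submoduleE(1)[OF K'(1)] by blast
  then have "restrict F' (carrier M) \<in> mod_hom R M N"
    using F'(1) unfolding linear_on_def mod_hom_def by auto
  moreover have "(\<lambda>x\<in>carrier M. \<lambda>y\<in>carrier M. B x y) ` carrier M = mod_hom R M N"
    using nondeg unfolding nondegenerate_def mod_iso_def Hom_module_def by (auto simp: bij_betw_def)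
  ultimately have "restrict F' (carrier M) \<in> (\<lambda>x\<in>carrier M. \<lambda>y\<in>carrier M. B x y) ` carrier M" by simp
  then obtain x where x: "x \<in> carrier M" "restrict F' (carrier M) = (\<lambda>y\<in>carrier M. B x y)" by auto
  then have Bx: "B x y = F' y" if "y \<in> carrier M" for y using that by (metis restrict_apply')
  have "x \<in> perp M N B L"
    unfolding perp_def using x(1) Bx F(2) F'(2) K(2) M.submoduleE(1)[OF L] by (auto simp: subset_iff)
  moreover have "B x a \<noteq> \<zero>\<^bsub>N\<^esub>" using Bx[OF a(1)] F'(2) K(3) F(3) c(2) by simp
  ultimately show ?thesis by blast
qed

end

section \<open>Layers and the lower level\<close>

lemma (in module) submodule_gen_submodule:
  assumes "S \<subseteq> carrier M"
  shows "submodule (gen_submodule R M S) R M"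
proof -
  have "submodule (\<Inter>H\<in>{H. submodule H R M \<and> S \<subseteq> H}. H) R M"
    using assms carrier_is_submodule by (intro submodule_INT) auto
  then show ?thesis by (simp add: gen_submodule_def)
qed

context chain_module
begin

text \<open>Numerator and denominator of \<open>\<rho>\<^sub>i(M)\<close> for \<open>i = 2 k + 1\<close>.\<close>

definition layer :: "nat \<Rightarrow> 'c set" where
  "layer k = pw k ` tors (2 * k + 1)"

definition sublayer :: "nat \<Rightarrow> 'c set" where
  "sublayer k = pw k ` tors (2 * k) <+>\<^bsub>M\<^esub> pw (k + 1) ` tors (2 * k + 2)"

lemma rho_odd_eq_quot_module:
  "rho_odd R (PIdl p) M (2 * k + 1) = quot_module (M\<lparr>carrier := layer k\<rparr>) (sublayer k)"
proof -
  have "(2 * k + 1) div 2 = k" "2 * k + 1 - 1 = 2 * k" "2 * k + 1 + 1 = 2 * k + 2" by simp_all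
  then show ?thesis
    unfolding rho_odd_def layer_def sublayer_def Let_def
    by (simp only: ideal_pow_PIdl ideal_tors_PIdl[OF power_closed]
        ideal_smult_PIdl[OF power_closed submodule_tors])
qed

lemma submodule_layer: "submodule (layer k) R M"
  unfolding layer_def by (intro submodule_smult_image submodule_tors) simp

lemma submodule_sublayer: "submodule (sublayer k) R M"
  unfolding sublayer_def by (intro submodule_set_add submodule_smult_image submodule_tors) simp_all

lemma mem_sublayer:
  "x \<in> sublayer k \<longleftrightarrow>
     (\<exists>u\<in>tors (2 * k). \<exists>u'\<in>tors (2 * k + 2). x = pw k u \<oplus>\<^bsub>M\<^esub> pw (k + 1) u')"
  unfolding sublayer_def set_add_def' by auto

lemma p_smult_tors: "x \<in> tors (Suc k) \<Longrightarrow> p \<odot>\<^bsub>M\<^esub> x \<in> tors k"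
  unfolding mem_tors using pw_p[of x k] by simp

lemma sublayer_subset_layer: "sublayer k \<subseteq> layer k"
proof
  fix x assume "x \<in> sublayer k"
  then obtain u u' where u: "u \<in> tors (2 * k)" and u': "u' \<in> tors (2 * k + 2)"
    and x: "x = pw k u \<oplus>\<^bsub>M\<^esub> pw (k + 1) u'" unfolding mem_sublayer by blast
  have "pw k (p \<odot>\<^bsub>M\<^esub> u') = pw (k + 1) u'" using tors_carrier[OF u'] by (simp add: pw_p del: nat_pow_Suc)
  moreover have "p \<odot>\<^bsub>M\<^esub> u' \<in> tors (2 * k + 1)" using u' by (intro p_smult_tors) simp
  moreover have "u \<in> tors (2 * k + 1)" using u tors_mono[of "2 * k" "2 * k + 1"] by (simp del: nat_pow_Suc) blast
  ultimately show "x \<in> layer k"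
    using submoduleE(5)[OF submodule_layer] unfolding x layer_def by (metis image_eqI)
qed

lemma submodule_lr: "submodule (lr R M) R M"
  unfolding lr_def by (rule submodule_gen_submodule) (auto simp: elt_tors_def)

lemma pw_tors_in_lr:
  assumes "a \<in> tors (2 * i)"
  shows "pw i a \<in> lr R M"
proof -
  have a: "a \<in> carrier M" using assms by (rule tors_carrier)
  have "pw i a \<in> tors i" using assms pw_in_tors_iff[OF a, of i i] by (simp add: mult_2)
  then have "pw i a \<in> elt_smult M (p [^] i) \<inter> tors i" using a unfolding elt_smult_def by blast
  then show ?thesis unfolding lr_def gen_submodule_def by (auto intro: power_closed)
qed

text \<open>Up to a unit every \<open>r\<close> is a power \<open>p\<^sup>i\<close>, and \<open>p\<^sup>i M \<inter> M[p\<^sup>i] = p\<^sup>i M[p\<^sup>2\<^sup>i]\<close>; hence \<open>lr(M)\<close> is generated by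
the elements \<open>p\<^sup>i a\<close> with \<open>p\<^sup>2\<^sup>i a = 0\<close>.\<close>

lemma lr_minimal:
  assumes H: "submodule H R M" and gen: "\<And>i a. a \<in> tors (2 * i) \<Longrightarrow> pw i a \<in> H"
  shows "lr R M \<subseteq> H"
  unfolding lr_def
proof (intro gen_submodule_minimal[OF H] UN_least subsetI)
  fix r y assume r: "r \<in> carrier R" and y: "y \<in> elt_smult M r \<inter> elt_tors M r"
  obtain u i where u: "u \<in> Units R" and ui: "r = u \<otimes> p [^] (i::nat)" using unit_times_power[OF r] by blast
  note uc = Units_closed[OF u]
  from y obtain x where x: "x \<in> carrier M" "y = r \<odot>\<^bsub>M\<^esub> x" unfolding elt_smult_def by blast
  have yc: "y \<in> carrier M" using y unfolding elt_tors_def by blast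
  have yp: "y = pw i (u \<odot>\<^bsub>M\<^esub> x)" using x uc smult_left_commute[of u "p [^] i" x] by (simp add: ui smult_assoc1)
  have "inv u \<otimes> r = p [^] i" unfolding ui using u uc by (simp add: m_assoc[symmetric])
  moreover have "r \<odot>\<^bsub>M\<^esub> y = \<zero>\<^bsub>M\<^esub>" using y unfolding elt_tors_def by blast
  ultimately have "pw i y = \<zero>\<^bsub>M\<^esub>"
    using smult_assoc1[OF Units_inv_closed[OF u] r yc] u by simp
  then have "pw (2 * i) (u \<odot>\<^bsub>M\<^esub> x) = \<zero>\<^bsub>M\<^esub>" unfolding yp using x uc by (simp add: pw_pw mult_2)
  then have "u \<odot>\<^bsub>M\<^esub> x \<in> tors (2 * i)" using x uc by (simp add: mem_tors)
  then show "y \<in> H" unfolding yp by (rule gen)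
qed

lemma sublayer_subset_lr: "sublayer k \<subseteq> lr R M"
proof
  fix x assume "x \<in> sublayer k"
  then obtain u u' where u: "u \<in> tors (2 * k)" and u': "u' \<in> tors (2 * k + 2)"
    and x: "x = pw k u \<oplus>\<^bsub>M\<^esub> pw (k + 1) u'" unfolding mem_sublayer by blast
  have "2 * k + 2 = 2 * (k + 1)" by simp
  then have "pw (k + 1) u' \<in> lr R M" using u' pw_tors_in_lr by metis
  then show "x \<in> lr R M"
    unfolding x using submoduleE(5)[OF submodule_lr] pw_tors_in_lr[OF u] by blast
qed

text \<open>The value of \<open>lr_class_sum\<close> at given representatives. It does not depend on them because the
denominators of the \<open>\<rho>\<^sub>i(M)\<close> lie in \<open>lr(M)\<close>.\<close>

lemma lr_class_sum_eq:
  assumes v: "\<And>i. \<lbrakk>i \<in> I; v i \<noteq> \<zero>\<^bsub>\<rho> i\<^esub>\<rbrakk> \<Longrightarrow> v i = sublayer (\<kappa> i) +>\<^bsub>M\<^esub> z i \<and> z i \<in> carrier M"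
  shows "lr_class_sum R M I \<rho> v = lr R M +>\<^bsub>M\<^esub> (\<Oplus>\<^bsub>M\<^esub>i\<in>{i \<in> I. v i \<noteq> \<zero>\<^bsub>\<rho> i\<^esub>}. z i)"
proof -
  interpret Q: module_with_submodule R M "lr R M"
    by (rule module_with_submoduleI[OF submodule_lr])
  interpret Qm: module R "quot_module M (lr R M)" by (rule Q.quot_is_module)
  define S where "S = {i \<in> I. v i \<noteq> \<zero>\<^bsub>\<rho> i\<^esub>}"
  have vS: "v i = sublayer (\<kappa> i) +>\<^bsub>M\<^esub> z i" and zS: "z i \<in> carrier M" if "i \<in> S" for i
    using that v unfolding S_def by blast+
  have rep: "x \<in> carrier M \<and> lr R M +>\<^bsub>M\<^esub> x = lr R M +>\<^bsub>M\<^esub> z i" if i: "i \<in> S" and x: "x \<in> v i" for i x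
  proof -
    interpret L: module_with_submodule R M "sublayer (\<kappa> i)"
      by (rule module_with_submoduleI[OF submodule_sublayer])
    have "x \<in> carrier M" "x \<ominus>\<^bsub>M\<^esub> z i \<in> sublayer (\<kappa> i)"
      using x L.mem_coset_iff[OF zS[OF i]] unfolding vS[OF i] by blast+
    then show ?thesis using Q.coset_eq_iff[OF _ zS[OF i]] sublayer_subset_lr by blast
  qed
  have const: "lr R M +>\<^bsub>M\<^esub> (\<Oplus>\<^bsub>M\<^esub>i\<in>S. x i) = lr R M +>\<^bsub>M\<^esub> (\<Oplus>\<^bsub>M\<^esub>i\<in>S. z i)"
    if x: "x \<in> (\<Pi>\<^sub>E i\<in>S. v i)" for x
  proof -
    have xi: "x i \<in> v i" if "i \<in> S" for i using x that by (rule PiE_mem)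
    have "lr R M +>\<^bsub>M\<^esub> (\<Oplus>\<^bsub>M\<^esub>i\<in>S. x i) = (\<Oplus>\<^bsub>quot_module M (lr R M)\<^esub>i\<in>S. lr R M +>\<^bsub>M\<^esub> x i)"
      using rep xi by (intro Q.finsum_quot[symmetric]) blast
    also have "\<dots> = (\<Oplus>\<^bsub>quot_module M (lr R M)\<^esub>i\<in>S. lr R M +>\<^bsub>M\<^esub> z i)"
      using rep xi zS Q.coset_in_quot by (intro Qm.M.finsum_cong') auto
    also have "\<dots> = lr R M +>\<^bsub>M\<^esub> (\<Oplus>\<^bsub>M\<^esub>i\<in>S. z i)"
      using zS by (rule Q.finsum_quot)
    finally show ?thesis .
  qed
  have "(\<lambda>i\<in>S. z i) \<in> (\<Pi>\<^sub>E i\<in>S. v i)"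
  proof (rule restrict_PiE_iff[THEN iffD2], rule ballI)
    fix i assume i: "i \<in> S"
    interpret L: module_with_submodule R M "sublayer (\<kappa> i)"
      by (rule module_with_submoduleI[OF submodule_sublayer])
    show "z i \<in> v i" unfolding vS[OF i] by (rule L.S.a_rcos_self[OF zS[OF i]])
  qed
  then have "(\<lambda>x. lr R M +>\<^bsub>M\<^esub> (\<Oplus>\<^bsub>M\<^esub>i\<in>S. x i)) ` (\<Pi>\<^sub>E i\<in>S. v i) = {lr R M +>\<^bsub>M\<^esub> (\<Oplus>\<^bsub>M\<^esub>i\<in>S. z i)}"
    using const by blast
  then show ?thesis unfolding lr_class_sum_def Let_def S_def by simp
qed

end

context chain_form
begin

lemma form_zero_left: "y \<in> carrier M \<Longrightarrow> B \<zero>\<^bsub>M\<^esub> y = \<zero>\<^bsub>N\<^esub>"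
  using form_smult_left[of \<zero> "\<zero>\<^bsub>M\<^esub>" y] form_closed by simp

lemma form_minus_left: "\<lbrakk>x \<in> carrier M; y \<in> carrier M\<rbrakk> \<Longrightarrow> B (\<ominus>\<^bsub>M\<^esub> x) y = \<ominus>\<^bsub>N\<^esub> B x y"
  using form_smult_left[of "\<ominus> \<one>" x y] form_closed by (simp add: M.smult_l_minus N.smult_l_minus)

lemma form_pw:
  "\<lbrakk>x \<in> carrier M; y \<in> carrier M\<rbrakk> \<Longrightarrow> B (M.pw i x) (M.pw j y) = N.pw (i + j) (B x y)"
  using form_closed by (simp add: form_smult_left form_smult_right N.pw_pw add.commute)

lemma submodule_perp:
  assumes X: "X \<subseteq> carrier M"
  shows "submodule (perp M N B X) R M"
proof -
  have mem: "a \<in> perp M N B X \<longleftrightarrow> a \<in> carrier M \<and> (\<forall>x\<in>X. B a x = \<zero>\<^bsub>N\<^esub>)" for a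
    unfolding perp_def by blast
  have Xc: "x \<in> carrier M" if "x \<in> X" for x using X that by blast
  show ?thesis
    by (rule M.submoduleI)
      (auto simp: mem Xc form_zero_left form_minus_left form_add_left form_smult_left)
qed

lemma perpI:
  assumes "x \<in> carrier M" "X \<subseteq> carrier M" "\<And>y. y \<in> X \<Longrightarrow> B y x = \<zero>\<^bsub>N\<^esub>"
  shows "x \<in> perp M N B X"
  unfolding perp_def
proof (intro CollectI conjI ballI)
  fix y assume y: "y \<in> X"
  then have "B x y = B y x" using assms(1,2) form_sym by blast
  then show "B x y = \<zero>\<^bsub>N\<^esub>" using assms(3)[OF y] by simp
qed (rule assms(1))

lemma perpD:
  assumes "x \<in> perp M N B X" "X \<subseteq> carrier M" "y \<in> X"
  shows "B y x = \<zero>\<^bsub>N\<^esub>"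
proof -
  have "x \<in> carrier M" "B x y = \<zero>\<^bsub>N\<^esub>" using assms(1,3) unfolding perp_def by blast+
  moreover from this have "B y x = B x y" using assms(2,3) form_sym by blast
  ultimately show ?thesis by simp
qed

text \<open>The value is \<open>p\<^sup>i\<^sup>+\<^sup>j \<langle>a, b\<rangle>\<close>, and \<open>p\<^sup>i\<^sup>+\<^sup>j\<close> kills \<open>a\<close> if \<open>i \<le> j\<close> and \<open>b\<close> if \<open>i > j\<close>. Thus the generators of \<open>lr(M)\<close>
are orthogonal to all layers, which makes the form on classes modulo \<open>lr(M)\<close> well defined.\<close>

lemma form_pw_tors_eq_zero:
  assumes a: "a \<in> M.tors (2 * i)" and b: "b \<in> M.tors (2 * j + 1)"
  shows "B (M.pw i a) (M.pw j b) = \<zero>\<^bsub>N\<^esub>"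
proof -
  note ac = M.tors_carrier[OF a] and bc = M.tors_carrier[OF b]
  show ?thesis
  proof (cases "i \<le> j")
    case True
    then have "a \<in> M.tors (i + j)" using a M.tors_mono[of "2 * i" "i + j"] by auto
    then have "N.pw (i + j) (B a b) = \<zero>\<^bsub>N\<^esub>"
      using form_smult_left[OF power_closed ac bc] form_zero_left[OF bc] by (metis M.mem_tors)
    then show ?thesis using form_pw[OF ac bc] by simp
  next
    case False
    then have "b \<in> M.tors (i + j)" using b M.tors_mono[of "2 * j + 1" "i + j"] by auto
    then have "N.pw (i + j) (B a b) = \<zero>\<^bsub>N\<^esub>"
      using form_smult_left[OF power_closed bc ac] form_zero_left[OF ac] form_sym[OF ac bc]
      by (metis M.mem_tors)
    then show ?thesis using form_pw[OF ac bc] by simp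
  qed
qed

lemma lr_perp_layer:
  assumes x: "x \<in> M.layer k" and y: "y \<in> lr R M"
  shows "B y x = \<zero>\<^bsub>N\<^esub>"
proof -
  have xc: "x \<in> carrier M" using x M.submoduleE(1)[OF M.submodule_layer] by blast
  have "lr R M \<subseteq> perp M N B {x}"
  proof (rule M.lr_minimal)
    show "submodule (perp M N B {x}) R M" using xc by (intro submodule_perp) simp
    show "M.pw i a \<in> perp M N B {x}" if "a \<in> M.tors (2 * i)" for i a
      using that x form_pw_tors_eq_zero M.tors_carrier[OF that] unfolding perp_def M.layer_def by auto
  qed
  then show ?thesis using y unfolding perp_def by blast
qed

lemma lr_perp_lr:
  assumes x: "x \<in> lr R M" and y: "y \<in> lr R M"
  shows "B y x = \<zero>\<^bsub>N\<^esub>"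
proof -
  have lrc: "lr R M \<subseteq> carrier M" by (rule M.submoduleE(1)[OF M.submodule_lr])
  have "lr R M \<subseteq> perp M N B (lr R M)"
  proof (rule M.lr_minimal)
    show "submodule (perp M N B (lr R M)) R M" using lrc by (rule submodule_perp)
    fix i a assume a: "a \<in> M.tors (2 * i)"
    then have "a \<in> M.tors (2 * i + 1)" using M.tors_mono[of "2 * i" "2 * i + 1"] by auto
    then have "M.pw i a \<in> M.layer i" unfolding M.layer_def by blast
    then show "M.pw i a \<in> perp M N B (lr R M)"
      using lr_perp_layer M.tors_carrier[OF a] by (intro perpI[OF _ lrc]) auto
  qed
  then show ?thesis using x y unfolding perp_def by blast
qed

lemma class_form_lr_coset:
  assumes z: "z \<in> carrier M" and perp: "\<And>y. y \<in> lr R M \<Longrightarrow> B y z = \<zero>\<^bsub>N\<^esub>"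
  shows "class_form B (lr R M +>\<^bsub>M\<^esub> z) (lr R M +>\<^bsub>M\<^esub> z) = B z z"
proof -
  note lrc = subsetD[OF M.submoduleE(1)[OF M.submodule_lr]]
  have zero: "\<zero>\<^bsub>M\<^esub> \<in> lr R M" by (rule M.submodule_zero[OF M.submodule_lr])
  have "B (a \<oplus>\<^bsub>M\<^esub> z) (b \<oplus>\<^bsub>M\<^esub> z) = B z z" if "a \<in> lr R M" "b \<in> lr R M" for a b
  proof -
    have "B z b = \<zero>\<^bsub>N\<^esub>" using that perp form_sym[OF z lrc] by metis
    then show ?thesis
      using that lrc z perp lr_perp_lr form_closed by (simp add: form_add_left form_add_right)
  qed
  then have const: "B x y = B z z" if "x \<in> lr R M +>\<^bsub>M\<^esub> z" "y \<in> lr R M +>\<^bsub>M\<^esub> z" for x y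
    using that unfolding a_r_coset_def' by blast
  have "(\<lambda>(x, y). B x y) ` ((lr R M +>\<^bsub>M\<^esub> z) \<times> (lr R M +>\<^bsub>M\<^esub> z)) =
      (\<lambda>_. B z z) ` ((lr R M +>\<^bsub>M\<^esub> z) \<times> (lr R M +>\<^bsub>M\<^esub> z))"
    by (rule image_cong) (clarsimp simp: const)+
  also have "\<dots> = {B z z}"
    using zero unfolding a_r_coset_def'
    by (intro image_constant[of "(\<zero>\<^bsub>M\<^esub> \<oplus>\<^bsub>M\<^esub> z, \<zero>\<^bsub>M\<^esub> \<oplus>\<^bsub>M\<^esub> z)"] SigmaI) blast+
  finally show ?thesis unfolding class_form_def by (simp only: the_elem_eq)
qed

text \<open>An isotropic sum of elements of layers of index at least \<open>d\<close> has only trivial classes: these classes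
define an element \<open>v\<close> of the tail of the direct sum, and its form value is \<open>\<langle>\<Sum> z\<^sub>i, \<Sum> z\<^sub>i\<rangle>\<close>. The index map
\<open>\<kappa>\<close> covers the odd case, where \<open>\<rho>\<^sub>i\<close> belongs to \<open>k = (i - 1)/2\<close>, and the even case, where \<open>\<rho>\<^sub>i\<close> of the
original module is \<open>\<rho>\<^sub>i\<^sub>-\<^sub>1\<close> of the quotient and belongs to \<open>k = i/2 - 1\<close>.\<close>

lemma anisotropic_imp_in_sublayer:
  assumes aniso: "tail_anisotropic R M N B I \<rho> d"
    and \<rho>: "\<And>i. i \<in> I \<Longrightarrow> \<rho> i = rho_odd R (PIdl p) M (2 * \<kappa> i + 1)"
    and S: "finite S" "S \<subseteq> I" "\<And>i. i \<in> S \<Longrightarrow> d \<le> i"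
    and z: "\<And>i. i \<in> S \<Longrightarrow> z i \<in> M.layer (\<kappa> i)"
    and isotropic: "B (\<Oplus>\<^bsub>M\<^esub>i\<in>S. z i) (\<Oplus>\<^bsub>M\<^esub>i\<in>S. z i) = \<zero>\<^bsub>N\<^esub>"
    and j: "j \<in> S"
  shows "z j \<in> M.sublayer (\<kappa> j)"
proof -
  have zc: "z i \<in> carrier M" if "i \<in> S" for i
    using z[OF that] M.submoduleE(1)[OF M.submodule_layer] by blast
  have sub: "module_with_submodule R (M\<lparr>carrier := M.layer k\<rparr>) (M.sublayer k)" for k
  proof -
    interpret K: module R "M\<lparr>carrier := M.layer k\<rparr>"
      by (rule submodule.submodule_is_module[OF M.submodule_layer M.module_axioms])
    show ?thesis
      by (rule K.module_with_submoduleI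
          [OF M.submodule_relative[OF M.submodule_sublayer M.submodule_layer M.sublayer_subset_layer]])
  qed
  have rq: "\<rho> i = quot_module (M\<lparr>carrier := M.layer (\<kappa> i)\<rparr>) (M.sublayer (\<kappa> i))" if "i \<in> I" for i
    using \<rho>[OF that] M.rho_odd_eq_quot_module by simp
  have zero: "\<zero>\<^bsub>\<rho> i\<^esub> = M.sublayer (\<kappa> i)" if "i \<in> I" for i
    unfolding rq[OF that] by (simp add: quot_module_def)
  have coset_carrier: "M.sublayer (\<kappa> i) +>\<^bsub>M\<^esub> x \<in> carrier (\<rho> i)" if "i \<in> I" "x \<in> M.layer (\<kappa> i)" for i x
    using module_with_submodule.coset_in_quot[OF sub, of x "\<kappa> i"] that unfolding rq[OF that(1)] by simp
  have \<rho>_module: "module R (\<rho> i)" if "i \<in> I" for i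
    unfolding rq[OF that] by (rule module_with_submodule.quot_is_module[OF sub])
  then have group: "group (add_monoid (\<rho> i))" if "i \<in> I" for i
    using that abelian_group.a_group module.axioms(2) by blast
  have zero_carrier: "\<zero>\<^bsub>\<rho> i\<^esub> \<in> carrier (\<rho> i)" if "i \<in> I" for i
    using \<rho>_module[OF that] abelian_group.axioms(1) abelian_monoid.zero_closed module.axioms(2) by blast
  define v where "v = (\<lambda>i\<in>I. if i \<in> S then M.sublayer (\<kappa> i) +>\<^bsub>M\<^esub> z i else \<zero>\<^bsub>\<rho> i\<^esub>)"
  have v_coset_iff: "M.sublayer (\<kappa> i) +>\<^bsub>M\<^esub> z i = \<zero>\<^bsub>\<rho> i\<^esub> \<longleftrightarrow> z i \<in> M.sublayer (\<kappa> i)" if "i \<in> S" for i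
    using module_with_submodule.coset_eq_self_iff[OF sub, of "z i" "\<kappa> i"] z[OF that] zero[of i] that S(2)
    by auto
  \<comment> \<open>\<open>lr_class_sum\<close> adds up representatives over the support \<open>T\<close> of \<open>v\<close> only; the other \<open>z i\<close> lie in
    \<open>lr(M)\<close>, so that the sum over all of \<open>S\<close> has the same class.\<close>
  define T where "T = {i \<in> I. v i \<noteq> \<zero>\<^bsub>\<rho> i\<^esub>}"
  have T: "T = {i \<in> S. z i \<notin> M.sublayer (\<kappa> i)}"
    using S(2) v_coset_iff unfolding T_def v_def by auto
  have v_carrier: "v \<in> carrier (direct_sum I \<rho>)"
  proof -
    have "v \<in> (\<Pi>\<^sub>E i\<in>I. carrier (\<rho> i))"
      unfolding v_def using coset_carrier z zero_carrier by auto
    moreover have "finite {i \<in> I. v i \<noteq> \<zero>\<^bsub>\<rho> i\<^esub>}" using T S(1) unfolding T_def by simp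
    ultimately show ?thesis using group by (simp add: carrier_sum_group)
  qed
  have "lr_class_sum R M I \<rho> v = lr R M +>\<^bsub>M\<^esub> (\<Oplus>\<^bsub>M\<^esub>i\<in>T. z i)"
    unfolding T_def
  proof (rule M.lr_class_sum_eq)
    fix i assume "i \<in> I" "v i \<noteq> \<zero>\<^bsub>\<rho> i\<^esub>"
    then show "v i = M.sublayer (\<kappa> i) +>\<^bsub>M\<^esub> z i \<and> z i \<in> carrier M"
      using zc unfolding v_def by (auto split: if_splits)
  qed
  also have "\<dots> = lr R M +>\<^bsub>M\<^esub> (\<Oplus>\<^bsub>M\<^esub>i\<in>S. z i)"
  proof -
    interpret Q: module_with_submodule R M "lr R M"
      by (rule M.module_with_submoduleI[OF M.submodule_lr])
    interpret Qm: module R "quot_module M (lr R M)" by (rule Q.quot_is_module)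
    have "(\<Oplus>\<^bsub>quot_module M (lr R M)\<^esub>i\<in>T. lr R M +>\<^bsub>M\<^esub> z i) =
        (\<Oplus>\<^bsub>quot_module M (lr R M)\<^esub>i\<in>S. lr R M +>\<^bsub>M\<^esub> z i)"
    proof (rule Qm.M.add.finprod_mono_neutral_cong_left)
      show "lr R M +>\<^bsub>M\<^esub> z i = \<zero>\<^bsub>quot_module M (lr R M)\<^esub>" if "i \<in> S - T" for i
      proof -
        have "z i \<in> lr R M" using that M.sublayer_subset_lr unfolding T by blast
        then show ?thesis using Q.coset_eq_self_iff zc that by (simp add: Q.zero_quot)
      qed
    qed (use S(1) T zc Q.coset_in_quot in auto)
    moreover have "(\<Oplus>\<^bsub>quot_module M (lr R M)\<^esub>i\<in>T. lr R M +>\<^bsub>M\<^esub> z i) = lr R M +>\<^bsub>M\<^esub> (\<Oplus>\<^bsub>M\<^esub>i\<in>T. z i)"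
      using T zc by (intro Q.finsum_quot) auto
    moreover have "(\<Oplus>\<^bsub>quot_module M (lr R M)\<^esub>i\<in>S. lr R M +>\<^bsub>M\<^esub> z i) = lr R M +>\<^bsub>M\<^esub> (\<Oplus>\<^bsub>M\<^esub>i\<in>S. z i)"
      using zc by (intro Q.finsum_quot) auto
    ultimately show ?thesis by simp
  qed
  finally have sum_v: "lr_class_sum R M I \<rho> v = lr R M +>\<^bsub>M\<^esub> (\<Oplus>\<^bsub>M\<^esub>i\<in>S. z i)" .
  have lrc: "lr R M \<subseteq> carrier M" by (rule M.submoduleE(1)[OF M.submodule_lr])
  have "(\<Oplus>\<^bsub>M\<^esub>i\<in>S. z i) \<in> perp M N B (lr R M)"
  proof (rule M.submodule_finsum[OF submodule_perp[OF lrc]])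
    fix i assume "i \<in> S"
    then show "z i \<in> perp M N B (lr R M)"
      using lr_perp_layer[OF z] zc by (intro perpI[OF _ lrc]) auto
  qed
  then have "B y (\<Oplus>\<^bsub>M\<^esub>i\<in>S. z i) = \<zero>\<^bsub>N\<^esub>" if "y \<in> lr R M" for y
    using perpD[OF _ lrc that] by blast
  moreover have "(\<Oplus>\<^bsub>M\<^esub>i\<in>S. z i) \<in> carrier M" using zc by (intro M.finsum_closed) auto
  ultimately have "direct_sum_form R M B I \<rho> v v = \<zero>\<^bsub>N\<^esub>"
    unfolding direct_sum_form_def sum_v using class_form_lr_coset isotropic by simp
  moreover have "\<forall>i\<in>I. i < d \<longrightarrow> v i = \<zero>\<^bsub>\<rho> i\<^esub>"
    using S(3) unfolding v_def by (auto simp: not_le[symmetric])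
  ultimately have "v = \<one>\<^bsub>direct_sum I \<rho>\<^esub>"
    using aniso v_carrier unfolding tail_anisotropic_def by blast
  then have "v j = \<zero>\<^bsub>\<rho> j\<^esub>" using j S(2) by (auto simp: restrict_def)
  then show ?thesis using v_coset_iff[OF j] j S(2) unfolding v_def by auto
qed

text \<open>Applied to \<open>z = p\<^sup>k x\<close>, the preceding lemma gives \<open>p\<^sup>k\<^sup>+\<^sup>t w\<^sub>t = p\<^sup>k\<^sup>+\<^sup>t (u + p u')\<close>. Cancelling \<open>p\<^sup>k\<^sup>+\<^sup>t\<close> costs an element of
\<open>M[p\<^sup>k\<^sup>+\<^sup>t] \<subseteq> M[p\<^sup>2\<^sup>(\<^sup>k\<^sup>+\<^sup>t\<^sup>)]\<close>, which is absorbed into \<open>u\<close>.\<close>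

lemma anisotropic_imp_split:
  assumes aniso: "tail_anisotropic R M N B I \<rho> d"
    and \<rho>: "\<And>i. i \<in> I \<Longrightarrow> \<rho> i = rho_odd R (PIdl p) M (2 * \<kappa> i + 1)"
    and \<iota>: "\<And>t. t < n \<Longrightarrow> \<iota> t \<in> I \<and> d \<le> \<iota> t \<and> \<kappa> (\<iota> t) = k + t"
    and w: "\<And>t. t < n \<Longrightarrow> w t \<in> M.tors (2 * (k + t) + 1)"
    and x: "x = (\<Oplus>\<^bsub>M\<^esub>t\<in>{..<n}. M.pw t (w t))"
    and isotropic: "B (M.pw k x) (M.pw k x) = \<zero>\<^bsub>N\<^esub>"
    and t: "t < n"
  shows "\<exists>u\<in>M.tors (2 * (k + t)). \<exists>u'\<in>M.tors (2 * (k + t) + 2). w t = u \<oplus>\<^bsub>M\<^esub> p \<odot>\<^bsub>M\<^esub> u'"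
proof -
  define z where "z i = M.pw (\<kappa> i) (w (\<kappa> i - k))" for i
  note wc = M.tors_carrier[OF w]
  have z\<iota>: "z (\<iota> t) = M.pw (k + t) (w t)" if "t < n" for t
    using \<iota>[OF that] unfolding z_def by simp
  have inj: "inj_on \<iota> {..<n}" using \<iota> by (auto simp: inj_on_def) (metis add_left_cancel)
  have "(\<Oplus>\<^bsub>M\<^esub>i\<in>\<iota> ` {..<n}. z i) = (\<Oplus>\<^bsub>M\<^esub>t\<in>{..<n}. z (\<iota> t))"
    using z\<iota> wc by (intro M.finsum_reindex[OF _ inj]) auto
  also have "\<dots> = (\<Oplus>\<^bsub>M\<^esub>t\<in>{..<n}. M.pw k (M.pw t (w t)))"
    using z\<iota> wc M.pw_pw by (intro M.finsum_cong') auto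
  also have "\<dots> = M.pw k x"
    unfolding x using wc by (intro M.finsum_smult_ldistr[symmetric]) auto
  finally have sum: "(\<Oplus>\<^bsub>M\<^esub>i\<in>\<iota> ` {..<n}. z i) = M.pw k x" .
  have "z (\<iota> t) \<in> M.sublayer (\<kappa> (\<iota> t))"
  proof (rule anisotropic_imp_in_sublayer[OF aniso \<rho>, where S = "\<iota> ` {..<n}"])
    show "z i \<in> M.layer (\<kappa> i)" if "i \<in> \<iota> ` {..<n}" for i
      using that z\<iota> \<iota> w unfolding M.layer_def by auto
  qed (use \<iota> t isotropic sum in auto)
  then obtain u u' where u: "u \<in> M.tors (2 * (k + t))" and u': "u' \<in> M.tors (2 * (k + t) + 2)"
    and eq: "M.pw (k + t) (w t) = M.pw (k + t) u \<oplus>\<^bsub>M\<^esub> M.pw (k + t + 1) u'"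
    using z\<iota>[OF t] \<iota>[OF t] unfolding M.mem_sublayer by auto
  note uc = M.tors_carrier[OF u] and uc' = M.tors_carrier[OF u']
  let ?r = "w t \<ominus>\<^bsub>M\<^esub> (u \<oplus>\<^bsub>M\<^esub> p \<odot>\<^bsub>M\<^esub> u')"
  have rc: "?r \<in> carrier M" using wc[OF t] uc uc' by simp
  have "M.pw (k + t) (u \<oplus>\<^bsub>M\<^esub> p \<odot>\<^bsub>M\<^esub> u') = M.pw (k + t) (w t)"
    unfolding eq using uc uc' by (simp add: M.smult_r_distr M.pw_p del: nat_pow_Suc)
  then have "M.pw (k + t) ?r = \<zero>\<^bsub>M\<^esub>"
    using wc[OF t] uc uc' by (simp add: M.smult_minus_right M.diff_eq_zero_iff)
  then have "?r \<in> M.tors (2 * (k + t))"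
    using rc M.tors_mono[of "k + t" "2 * (k + t)"] by (auto simp: M.mem_tors)
  then have "u \<oplus>\<^bsub>M\<^esub> ?r \<in> M.tors (2 * (k + t))"
    using u M.submoduleE(5)[OF M.submodule_tors] by blast
  moreover have "w t = (u \<oplus>\<^bsub>M\<^esub> ?r) \<oplus>\<^bsub>M\<^esub> p \<odot>\<^bsub>M\<^esub> u'"
    by (rule M.add_diff_split) (use wc[OF t] uc uc' in auto)
  ultimately show ?thesis using u' by blast
qed

end

section \<open>The form modulo the socle\<close>

context chain_module
begin

lemma mem_socle: "x \<in> ideal_tors M (PIdl p) \<longleftrightarrow> x \<in> carrier M \<and> p \<odot>\<^bsub>M\<^esub> x = \<zero>\<^bsub>M\<^esub>"
  by (simp add: ideal_tors_PIdl elt_tors_def)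

lemma module_with_socle: "module_with_submodule R M (ideal_tors M (PIdl p))"
  by (rule module_with_submoduleI) (simp add: ideal_tors_PIdl submodule_elt_tors)

lemma socle_coset_eq_iff:
  assumes "x \<in> carrier M" "y \<in> carrier M"
  shows "ideal_tors M (PIdl p) +>\<^bsub>M\<^esub> x = ideal_tors M (PIdl p) +>\<^bsub>M\<^esub> y \<longleftrightarrow> p \<odot>\<^bsub>M\<^esub> x = p \<odot>\<^bsub>M\<^esub> y"
proof -
  interpret H: module_with_submodule R M "ideal_tors M (PIdl p)" by (rule module_with_socle)
  show ?thesis
    using assms by (simp add: H.coset_eq_iff mem_socle smult_minus_right diff_eq_zero_iff)
qed

text \<open>Torsion exponents drop by one in \<open>M/M[p]\<close>. This shift brings the even levels \<open>h\<close> of \<open>M\<close> into the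
odd case for the quotient.\<close>

lemma socle_coset_in_tors_iff:
  assumes x: "x \<in> carrier M"
  shows "ideal_tors M (PIdl p) +>\<^bsub>M\<^esub> x \<in> elt_tors (mod_soc (PIdl p) M) (p [^] k) \<longleftrightarrow> x \<in> tors (Suc k)"
proof -
  interpret H: module_with_submodule R M "ideal_tors M (PIdl p)" by (rule module_with_socle)
  have "p \<odot>\<^bsub>M\<^esub> pw k x = pw (Suc k) x"
    using x smult_left_commute[of p "p [^] k" x] pw_p[OF x, of k] by simp
  then show ?thesis
    using x H.coset_in_quot[OF x] H.coset_eq_self_iff[OF pw_closed[OF x, of k]] unfolding elt_tors_def
    by (simp add: H.smult_quot H.zero_quot mem_socle del: nat_pow_Suc Group.nat_pow_Suc)
qed

text \<open>The submodule \<open>p S\<close> is \<open>0\<close> or \<open>S\<close>; in the second case \<open>S = p\<^sup>n S = 0\<close>.\<close>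

lemma simple_module_p_torsion:
  assumes S: "submodule S R M" and simple: "simple_module R (M\<lparr>carrier := S\<rparr>)"
  shows "S \<subseteq> elt_tors M p"
proof -
  let ?pS = "(\<lambda>x. p \<odot>\<^bsub>M\<^esub> x) ` S"
  note Sc = subsetD[OF submoduleE(1)[OF S]]
  have "?pS \<subseteq> S" using submoduleE(4)[OF S uniformizer_closed] by blast
  then have "submodule ?pS R (M\<lparr>carrier := S\<rparr>)"
    by (intro submodule_relative submodule_smult_image S) simp_all
  then have "?pS = {\<zero>\<^bsub>M\<^esub>} \<or> ?pS = S" using simple unfolding simple_module_def by simp
  moreover have False if eq: "?pS = S"
  proof -
    have "S \<subseteq> pw k ` S" for k
    proof (induction k)
      case 0
      show ?case
      proof
        fix x assume "x \<in> S"
        then show "x \<in> pw 0 ` S" using pw_0[OF Sc] by (intro image_eqI[of _ _ x]) metis+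
      qed
    next
      case (Suc k)
      show ?case
      proof
        fix x assume "x \<in> S"
        then obtain y where y: "y \<in> S" "x = pw k y" using Suc by blast
        then obtain z where z: "z \<in> S" "y = p \<odot>\<^bsub>M\<^esub> z" using eq by blast
        then have "x = pw (Suc k) z" using y pw_p[OF Sc] by blast
        then show "x \<in> pw (Suc k) ` S" using z by blast
      qed
    qed
    moreover obtain n :: nat where "p [^] n = \<zero>" using uniformizer_nilpotent by blast
    ultimately have "S \<subseteq> {\<zero>\<^bsub>M\<^esub>}" using Sc by (metis image_subset_iff singletonI smult_l_null subset_trans)
    then show False using simple submodule_zero[OF S] unfolding simple_module_def by auto
  qed
  ultimately show ?thesis using Sc unfolding elt_tors_def by blast
qed

lemma semisimple_module_p_torsion:
  assumes ss: "semisimple_module R M" and x: "x \<in> carrier M"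
  shows "p \<odot>\<^bsub>M\<^esub> x = \<zero>\<^bsub>M\<^esub>"
proof -
  obtain \<S> where \<S>: "\<forall>S\<in>\<S>. submodule S R M \<and> simple_module R (M\<lparr>carrier := S\<rparr>)"
    and gen: "gen_submodule R M (\<Union>\<S>) = carrier M"
    using ss unfolding semisimple_module_def by blast
  have "gen_submodule R M (\<Union>\<S>) \<subseteq> elt_tors M p"
    using \<S> simple_module_p_torsion
    by (intro gen_submodule_minimal submodule_elt_tors Union_least) blast+
  then show ?thesis using x gen unfolding elt_tors_def by blast
qed

end

context chain_form
begin

text \<open>Two elements are congruent modulo the \<open>p\<close>-torsion iff their multiples by \<open>p\<close> agree, so the value is
independent of representatives by \<open>p \<langle>x', y'\<rangle> = \<langle>p x', y'\<rangle> = \<langle>p x, y'\<rangle> = \<langle>x, p y'\<rangle> = \<langle>x, p y\<rangle>\<close>.\<close>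

lemma mod_soc_form_coset:
  assumes x: "x \<in> carrier M" and y: "y \<in> carrier M"
  shows "mod_soc_form (PIdl p) N B (ideal_tors M (PIdl p) +>\<^bsub>M\<^esub> x) (ideal_tors M (PIdl p) +>\<^bsub>M\<^esub> y) =
    ideal_tors N (PIdl p) +>\<^bsub>N\<^esub> B x y"
proof -
  interpret H: module_with_submodule R M "ideal_tors M (PIdl p)" by (rule M.module_with_socle)
  let ?X = "ideal_tors M (PIdl p) +>\<^bsub>M\<^esub> x" and ?Y = "ideal_tors M (PIdl p) +>\<^bsub>M\<^esub> y"
  have mem: "z' \<in> carrier M \<and> p \<odot>\<^bsub>M\<^esub> z' = p \<odot>\<^bsub>M\<^esub> z"
    if "z' \<in> ideal_tors M (PIdl p) +>\<^bsub>M\<^esub> z" "z \<in> carrier M" for z z'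
    using H.mem_coset_iff[OF that(2)] H.coset_eq_iff[OF _ that(2)] M.socle_coset_eq_iff[OF _ that(2)] that(1)
    by blast
  have const: "ideal_tors N (PIdl p) +>\<^bsub>N\<^esub> B x' y' = ideal_tors N (PIdl p) +>\<^bsub>N\<^esub> B x y"
    if x': "x' \<in> ?X" and y': "y' \<in> ?Y" for x' y'
  proof -
    have x'c: "x' \<in> carrier M" and y'c: "y' \<in> carrier M"
      and px: "p \<odot>\<^bsub>M\<^esub> x' = p \<odot>\<^bsub>M\<^esub> x" and py: "p \<odot>\<^bsub>M\<^esub> y' = p \<odot>\<^bsub>M\<^esub> y"
      using mem[OF x' x] mem[OF y' y] by blast+
    have "p \<odot>\<^bsub>N\<^esub> B x' y' = p \<odot>\<^bsub>N\<^esub> B x y'"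
      using form_smult_left[OF uniformizer_closed x'c y'c] form_smult_left[OF uniformizer_closed x y'c] px by metis
    also have "\<dots> = p \<odot>\<^bsub>N\<^esub> B x y"
      using form_smult_right[OF uniformizer_closed x y'c] form_smult_right[OF uniformizer_closed x y] py by metis
    finally show ?thesis using N.socle_coset_eq_iff form_closed x'c y'c x y by blast
  qed
  have "(\<lambda>(x, y). ideal_tors N (PIdl p) +>\<^bsub>N\<^esub> B x y) ` (?X \<times> ?Y) =
      (\<lambda>_. ideal_tors N (PIdl p) +>\<^bsub>N\<^esub> B x y) ` (?X \<times> ?Y)"
    by (rule image_cong) (clarsimp simp: const)+
  also have "\<dots> = {ideal_tors N (PIdl p) +>\<^bsub>N\<^esub> B x y}"
    using H.S.a_rcos_self[OF x] H.S.a_rcos_self[OF y] by (intro image_constant[of "(x, y)"] SigmaI)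
  finally show ?thesis unfolding mod_soc_form_def class_form_def by (simp only: the_elem_eq)
qed

lemma chain_form_mod_soc:
  "chain_form R p (mod_soc (PIdl p) M) (mod_soc (PIdl p) N) (mod_soc_form (PIdl p) N B)"
proof -
  interpret HM: module_with_submodule R M "ideal_tors M (PIdl p)" by (rule M.module_with_socle)
  interpret HN: module_with_submodule R N "ideal_tors N (PIdl p)" by (rule N.module_with_socle)
  interpret QM: module R "mod_soc (PIdl p) M" by (rule HM.quot_is_module)
  interpret QN: module R "mod_soc (PIdl p) N" by (rule HN.quot_is_module)
  have rep: "\<exists>x\<in>carrier M. X = ideal_tors M (PIdl p) +>\<^bsub>M\<^esub> x"
    if "X \<in> carrier (mod_soc (PIdl p) M)" for X
    using that unfolding HM.carrier_quot by blast
  show ?thesis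
  proof (intro chain_form.intro chain_ring_axioms symmetric_bilinear_form.intro
      QM.module_axioms QN.module_axioms symmetric_bilinear_form_axioms.intro)
    fix X Y assume "X \<in> carrier (mod_soc (PIdl p) M)" "Y \<in> carrier (mod_soc (PIdl p) M)"
    then obtain x y where x: "x \<in> carrier M" "X = ideal_tors M (PIdl p) +>\<^bsub>M\<^esub> x"
      and y: "y \<in> carrier M" "Y = ideal_tors M (PIdl p) +>\<^bsub>M\<^esub> y" using rep by metis
    show "mod_soc_form (PIdl p) N B X Y \<in> carrier (mod_soc (PIdl p) N)"
      unfolding x(2) y(2) mod_soc_form_coset[OF x(1) y(1)]
      by (rule HN.coset_in_quot[OF form_closed[OF x(1) y(1)]])
    show "mod_soc_form (PIdl p) N B X Y = mod_soc_form (PIdl p) N B Y X"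
      unfolding x(2) y(2) mod_soc_form_coset[OF x(1) y(1)] mod_soc_form_coset[OF y(1) x(1)]
      using form_sym[OF x(1) y(1)] by simp
    {
      fix r assume r: "r \<in> carrier R"
      show "mod_soc_form (PIdl p) N B (r \<odot>\<^bsub>mod_soc (PIdl p) M\<^esub> X) Y =
          r \<odot>\<^bsub>mod_soc (PIdl p) N\<^esub> mod_soc_form (PIdl p) N B X Y"
        using r x(1) y(1) form_closed[OF x(1) y(1)]
        by (simp add: x(2) y(2) HM.smult_quot HN.smult_quot mod_soc_form_coset form_smult_left)
      show "mod_soc_form (PIdl p) N B X (r \<odot>\<^bsub>mod_soc (PIdl p) M\<^esub> Y) =
          r \<odot>\<^bsub>mod_soc (PIdl p) N\<^esub> mod_soc_form (PIdl p) N B X Y"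
        using r x(1) y(1) form_closed[OF x(1) y(1)]
        by (simp add: x(2) y(2) HM.smult_quot HN.smult_quot mod_soc_form_coset form_smult_right)
    }
    fix Z assume "Z \<in> carrier (mod_soc (PIdl p) M)"
    then obtain z where z: "z \<in> carrier M" "Z = ideal_tors M (PIdl p) +>\<^bsub>M\<^esub> z" using rep by metis
    show "mod_soc_form (PIdl p) N B (X \<oplus>\<^bsub>mod_soc (PIdl p) M\<^esub> Y) Z =
        mod_soc_form (PIdl p) N B X Z \<oplus>\<^bsub>mod_soc (PIdl p) N\<^esub> mod_soc_form (PIdl p) N B Y Z"
      using x(1) y(1) z(1) form_closed[OF x(1) z(1)] form_closed[OF y(1) z(1)]
      by (simp add: x(2) y(2) z(2) HM.add_quot HN.add_quot mod_soc_form_coset form_add_left)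
    show "mod_soc_form (PIdl p) N B X (Y \<oplus>\<^bsub>mod_soc (PIdl p) M\<^esub> Z) =
        mod_soc_form (PIdl p) N B X Y \<oplus>\<^bsub>mod_soc (PIdl p) N\<^esub> mod_soc_form (PIdl p) N B X Z"
      using x(1) y(1) z(1) form_closed[OF x(1) z(1)] form_closed[OF x(1) y(1)]
      by (simp add: x(2) y(2) z(2) HM.add_quot HN.add_quot mod_soc_form_coset form_add_right)
  qed
qed

section \<open>Descent along the filtration\<close>

lemma pw_form_eq_zero:
  assumes x: "x \<in> carrier M" and px: "p \<odot>\<^bsub>N\<^esub> B x x = \<zero>\<^bsub>N\<^esub>" and k: "k \<ge> 1"
  shows "N.pw k (B x x) = \<zero>\<^bsub>N\<^esub>"
proof -
  obtain j where j: "k = Suc j" using k by (cases k) auto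
  show ?thesis unfolding j using N.pw_p[OF form_closed[OF x x], of j] px by simp
qed

text \<open>For \<open>h = 2 k + 1\<close> with \<open>k \<ge> 1\<close> the vector \<open>p\<^sup>k x\<close> is isotropic, its value being \<open>p\<^sup>2\<^sup>k \<langle>x, x\<rangle>\<close>.\<close>

lemma ur_level_descent_odd:
  assumes aniso: "odd_tail_anisotropic R (PIdl p) M N B d"
    and x: "x \<in> M.ur_level h" and h: "2 \<le> h" "d \<le> h" "odd h"
    and px: "p \<odot>\<^bsub>N\<^esub> B x x = \<zero>\<^bsub>N\<^esub>"
  shows "x \<in> M.ur_level (h - 1)"
proof -
  obtain k where k: "h = 2 * k + 1" using \<open>odd h\<close> by (elim oddE)
  then have k1: "k \<ge> 1" using h(1) by simp
  have h1: "1 \<le> h" using h(1) by simp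
  have xc: "x \<in> carrier M" using x M.submoduleE(1)[OF M.submodule_ur_level] by blast
  obtain n w where w: "\<And>t. t < n \<Longrightarrow> w t \<in> M.tors (h + 2 * t)"
    and xw: "x = (\<Oplus>\<^bsub>M\<^esub>t\<in>{..<n}. M.pw t (w t))"
    using M.ur_level_finite_expansion[OF x h1] by blast
  show ?thesis
  proof (rule M.ur_level_step[OF xw h1])
    fix t assume t: "t < n"
    have "\<exists>u\<in>M.tors (2 * (k + t)). \<exists>u'\<in>M.tors (2 * (k + t) + 2). w t = u \<oplus>\<^bsub>M\<^esub> p \<odot>\<^bsub>M\<^esub> u'"
    proof (rule anisotropic_imp_split[where \<kappa> = "\<lambda>i. i div 2" and \<iota> = "\<lambda>t. h + 2 * t",
          OF aniso[unfolded odd_tail_anisotropic_def] _ _ _ xw _ t])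
      show "rho_odd R (PIdl p) M i = rho_odd R (PIdl p) M (2 * (i div 2) + 1)" if "i \<in> {i. odd i}" for i
        using that by simp
      show "h + 2 * t \<in> {i. odd i} \<and> d \<le> h + 2 * t \<and> (h + 2 * t) div 2 = k + t" for t
        using h k by simp
      show "w t \<in> M.tors (2 * (k + t) + 1)" if "t < n" for t
      proof -
        have "h + 2 * t = 2 * (k + t) + 1" using k by simp
        then show ?thesis using w[OF that] by metis
      qed
      show "B (M.pw k x) (M.pw k x) = \<zero>\<^bsub>N\<^esub>"
        unfolding form_pw[OF xc xc] using k1 by (intro pw_form_eq_zero[OF xc px]) simp
    qed
    moreover have "2 * (k + t) = h - 1 + 2 * t" "2 * (k + t) + 2 = h + 1 + 2 * t" using k by simp_all
    ultimately show "\<exists>u\<in>M.tors (h - 1 + 2 * t). \<exists>u'\<in>M.tors (h + 1 + 2 * t). w t = u \<oplus>\<^bsub>M\<^esub> p \<odot>\<^bsub>M\<^esub> u'"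
      by metis
  qed
qed

text \<open>For \<open>h = 2 k + 2\<close> the value \<open>p\<^sup>2\<^sup>k \<langle>x, x\<rangle>\<close> of the form at \<open>p\<^sup>k x\<close> lies in \<open>N[p]\<close>, even when \<open>k = 0\<close>, so the class of
\<open>p\<^sup>k x\<close> in \<open>M/M[p]\<close> is isotropic. The splitting of the coefficients in \<open>M/M[p]\<close> lifts to \<open>M\<close> up to an element of
\<open>M[p]\<close>, which is absorbed into the first summand.\<close>

lemma ur_level_descent_even:
  assumes aniso: "even_tail_anisotropic R (PIdl p) M N B d"
    and x: "x \<in> M.ur_level h" and h: "2 \<le> h" "d \<le> h" "even h"
    and px: "p \<odot>\<^bsub>N\<^esub> B x x = \<zero>\<^bsub>N\<^esub>"
  shows "x \<in> M.ur_level (h - 1)"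
proof -
  obtain k where k: "h = 2 * k + 2"
  proof -
    obtain m where "h = 2 * m" using \<open>even h\<close> by (elim evenE)
    then have "h = 2 * (m - 1) + 2" using h(1) by simp
    then show thesis by (rule that)
  qed
  have h1: "1 \<le> h" using h(1) by simp
  have xc: "x \<in> carrier M" using x M.submoduleE(1)[OF M.submodule_ur_level] by blast
  obtain n w where w: "\<And>t. t < n \<Longrightarrow> w t \<in> M.tors (h + 2 * t)"
    and xw: "x = (\<Oplus>\<^bsub>M\<^esub>t\<in>{..<n}. M.pw t (w t))"
    using M.ur_level_finite_expansion[OF x h1] by blast
  note wc = M.tors_carrier[OF w]
  let ?H = "ideal_tors M (PIdl p)" and ?B = "mod_soc_form (PIdl p) N B"
  interpret H: module_with_submodule R M "?H" by (rule M.module_with_socle)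
  interpret HN: module_with_submodule R N "ideal_tors N (PIdl p)" by (rule N.module_with_socle)
  interpret Q: chain_form R p "mod_soc (PIdl p) M" "mod_soc (PIdl p) N" ?B
    by (rule chain_form_mod_soc)
  show ?thesis
  proof (rule M.ur_level_step[OF xw h1])
    fix t assume t: "t < n"
    have "\<exists>U\<in>Q.M.tors (2 * (k + t)). \<exists>U'\<in>Q.M.tors (2 * (k + t) + 2).
        ?H +>\<^bsub>M\<^esub> w t = U \<oplus>\<^bsub>mod_soc (PIdl p) M\<^esub> p \<odot>\<^bsub>mod_soc (PIdl p) M\<^esub> U'"
    proof (rule Q.anisotropic_imp_split[where \<kappa> = "\<lambda>i. i div 2 - 1" and \<iota> = "\<lambda>t. h + 2 * t"
          and w = "\<lambda>t. ?H +>\<^bsub>M\<^esub> w t" and x = "?H +>\<^bsub>M\<^esub> x",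
          OF aniso[unfolded even_tail_anisotropic_def] _ _ _ _ _ t])
      show "rho_even R (PIdl p) M i = rho_odd R (PIdl p) (mod_soc (PIdl p) M) (2 * (i div 2 - 1) + 1)"
        if i: "i \<in> {i. even i \<and> 2 \<le> i}" for i
      proof -
        have "2 * (i div 2 - 1) + 1 = i - 1" using i by auto
        then show ?thesis unfolding rho_even_def by simp
      qed
      show "h + 2 * t \<in> {i. even i \<and> 2 \<le> i} \<and> d \<le> h + 2 * t \<and> (h + 2 * t) div 2 - 1 = k + t" for t
        using h k by simp
      show "?H +>\<^bsub>M\<^esub> w t \<in> Q.M.tors (2 * (k + t) + 1)" if "t < n" for t
      proof -
        have "h + 2 * t = Suc (2 * (k + t) + 1)" using k by simp
        then show ?thesis using w[OF that] M.socle_coset_in_tors_iff[OF wc[OF that]] by metis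
      qed
      have "?H +>\<^bsub>M\<^esub> x = (\<Oplus>\<^bsub>mod_soc (PIdl p) M\<^esub>t\<in>{..<n}. ?H +>\<^bsub>M\<^esub> M.pw t (w t))"
        unfolding xw using wc by (intro H.finsum_quot[symmetric]) simp
      also have "\<dots> = (\<Oplus>\<^bsub>mod_soc (PIdl p) M\<^esub>t\<in>{..<n}. Q.M.pw t (?H +>\<^bsub>M\<^esub> w t))"
        using wc H.coset_in_quot by (intro Q.M.M.finsum_cong') (auto simp: H.smult_quot)
      finally show "?H +>\<^bsub>M\<^esub> x = (\<Oplus>\<^bsub>mod_soc (PIdl p) M\<^esub>t\<in>{..<n}. Q.M.pw t (?H +>\<^bsub>M\<^esub> w t))" .
      have "p \<odot>\<^bsub>N\<^esub> B (M.pw k x) (M.pw k x) = N.pw (Suc (k + k)) (B x x)"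
        unfolding form_pw[OF xc xc]
        using N.smult_left_commute[of p "p [^] (k + k)" "B x x"] N.pw_p[of "B x x" "k + k"] form_closed[OF xc xc]
        by simp
      also have "\<dots> = \<zero>\<^bsub>N\<^esub>" by (rule pw_form_eq_zero[OF xc px]) simp
      finally have "B (M.pw k x) (M.pw k x) \<in> ideal_tors N (PIdl p)"
        using N.mem_socle form_closed M.pw_closed[OF xc] by blast
      then have "ideal_tors N (PIdl p) +>\<^bsub>N\<^esub> B (M.pw k x) (M.pw k x) = \<zero>\<^bsub>mod_soc (PIdl p) N\<^esub>"
        using HN.coset_eq_self_iff form_closed M.pw_closed[OF xc] by (simp add: HN.zero_quot)
      then show "?B (Q.M.pw k (?H +>\<^bsub>M\<^esub> x)) (Q.M.pw k (?H +>\<^bsub>M\<^esub> x)) = \<zero>\<^bsub>mod_soc (PIdl p) N\<^esub>"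
        using xc by (simp add: H.smult_quot mod_soc_form_coset)
    qed
    then obtain U U' where U: "U \<in> Q.M.tors (2 * (k + t))" and U': "U' \<in> Q.M.tors (2 * (k + t) + 2)"
      and split: "?H +>\<^bsub>M\<^esub> w t = U \<oplus>\<^bsub>mod_soc (PIdl p) M\<^esub> p \<odot>\<^bsub>mod_soc (PIdl p) M\<^esub> U'" by blast
    have rep: "\<exists>v\<in>carrier M. V = ?H +>\<^bsub>M\<^esub> v" if "V \<in> Q.M.tors j" for V j
      using Q.M.tors_carrier[OF that] unfolding H.carrier_quot by blast
    obtain u where uc: "u \<in> carrier M" and u: "U = ?H +>\<^bsub>M\<^esub> u" using rep[OF U] by blast
    obtain u' where uc': "u' \<in> carrier M" and u': "U' = ?H +>\<^bsub>M\<^esub> u'" using rep[OF U'] by blast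
    have ut: "u \<in> M.tors (Suc (2 * (k + t)))" using U M.socle_coset_in_tors_iff[OF uc] unfolding u by blast
    have ut': "u' \<in> M.tors (Suc (2 * (k + t) + 2))" using U' M.socle_coset_in_tors_iff[OF uc'] unfolding u' by blast
    let ?s = "w t \<ominus>\<^bsub>M\<^esub> (u \<oplus>\<^bsub>M\<^esub> p \<odot>\<^bsub>M\<^esub> u')"
    have sc: "?s \<in> carrier M" using wc[OF t] uc uc' by simp
    have "?H +>\<^bsub>M\<^esub> w t = ?H +>\<^bsub>M\<^esub> (u \<oplus>\<^bsub>M\<^esub> p \<odot>\<^bsub>M\<^esub> u')"
      using split uc uc' unfolding u u' by (simp add: H.smult_quot H.add_quot)
    then have "?s \<in> ?H" using H.coset_eq_iff wc[OF t] uc uc' by simp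
    then have "?s \<in> M.tors 1" by (simp add: M.mem_socle elt_tors_def)
    then have "?s \<in> M.tors (Suc (2 * (k + t)))" using M.tors_mono[of 1 "Suc (2 * (k + t))"] by auto
    then have "u \<oplus>\<^bsub>M\<^esub> ?s \<in> M.tors (Suc (2 * (k + t)))"
      using ut M.submoduleE(5)[OF M.submodule_tors] by blast
    moreover have "w t = (u \<oplus>\<^bsub>M\<^esub> ?s) \<oplus>\<^bsub>M\<^esub> p \<odot>\<^bsub>M\<^esub> u'"
      by (rule M.add_diff_split) (use wc[OF t] uc uc' in auto)
    moreover have "Suc (2 * (k + t)) = h - 1 + 2 * t" "Suc (2 * (k + t) + 2) = h + 1 + 2 * t"
      using k by simp_all
    ultimately show "\<exists>u\<in>M.tors (h - 1 + 2 * t). \<exists>u'\<in>M.tors (h + 1 + 2 * t). w t = u \<oplus>\<^bsub>M\<^esub> p \<odot>\<^bsub>M\<^esub> u'"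
      using ut' by metis
  qed
qed

lemma anisotropic_imp_in_ur_level:
  assumes "2 \<le> d" and even: "even_tail_anisotropic R (PIdl p) M N B d"
    and odd: "odd_tail_anisotropic R (PIdl p) M N B d"
    and x: "x \<in> carrier M" and px: "p \<odot>\<^bsub>N\<^esub> B x x = \<zero>\<^bsub>N\<^esub>"
  shows "x \<in> M.ur_level (d - 1)"
proof -
  obtain h where h: "h \<ge> d" "M.ur_level h = carrier M" using M.ur_level_eventually_carrier by blast
  have "d - 1 \<le> h" using h(1) by simp
  then show ?thesis
  proof (induction rule: inc_induct)
    case base
    show ?case using x h(2) by simp
  next
    case (step n)
    then have "2 \<le> Suc n" "d \<le> Suc n" using \<open>2 \<le> d\<close> by simp_all
    then have "x \<in> M.ur_level (Suc n - 1)"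
      using ur_level_descent_odd[OF odd step.IH _ _ _ px] ur_level_descent_even[OF even step.IH _ _ _ px]
      by blast
    then show ?case by simp
  qed
qed

text \<open>The inclusion of \<open>ur\<^sub>s(M)\<close> in the orthogonal complement of \<open>lr\<^sub>s(M)\<close>, on the generators \<open>p\<^sup>i c\<close> of the latter: for
\<open>x = a + p\<^sup>i\<^sup>-\<^sup>s\<^sup>+\<^sup>1 b\<close> with \<open>p\<^sup>i a = 0\<close>, the power \<open>p\<^sup>i\<close> can be moved to \<open>a\<close>, and \<open>p\<^sup>i\<^sup>-\<^sup>s\<^sup>+\<^sup>1\<close> can be moved to \<open>p\<^sup>i c\<close>.\<close>

lemma ur_level_perp:
  assumes x: "x \<in> M.ur_level s" and c: "c \<in> carrier M" and tors: "M.pw i c \<in> M.tors (i + 1 - s)"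
  shows "B x (M.pw i c) = \<zero>\<^bsub>N\<^esub>"
proof -
  obtain a b where a: "a \<in> M.tors i" and b: "b \<in> carrier M"
    and ab: "x = a \<oplus>\<^bsub>M\<^esub> M.pw (i + 1 - s) b"
    using x unfolding M.mem_ur_level by blast
  note ac = M.tors_carrier[OF a]
  have "B a (M.pw i c) = B (M.pw i a) c" using ac c by (simp add: form_smult_left form_smult_right)
  also have "\<dots> = \<zero>\<^bsub>N\<^esub>" using a c form_zero_left unfolding M.mem_tors by simp
  finally have 1: "B a (M.pw i c) = \<zero>\<^bsub>N\<^esub>" .
  have "B (M.pw (i + 1 - s) b) (M.pw i c) = B (M.pw (i + 1 - s) (M.pw i c)) b"
    using b c form_sym[OF b M.pw_closed[OF c]] by (simp add: form_smult_left)
  also have "\<dots> = \<zero>\<^bsub>N\<^esub>" using tors b form_zero_left unfolding M.mem_tors by simp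
  finally show ?thesis using 1 ac b c unfolding ab by (simp add: form_add_left)
qed

lemma semisimple_subquotient:
  assumes L: "submodule L R M" and iso: "L \<subseteq> perp M N B L"
    and ss: "semisimple_module R (quot_module (M\<lparr>carrier := perp M N B L\<rparr>) L)"
    and x: "x \<in> perp M N B L"
  shows "p \<odot>\<^bsub>M\<^esub> x \<in> L"
proof -
  let ?K = "perp M N B L"
  have K: "submodule ?K R M" by (rule submodule_perp[OF M.submoduleE(1)[OF L]])
  interpret K: module R "M\<lparr>carrier := ?K\<rparr>"
    by (rule submodule.submodule_is_module[OF K M.module_axioms])
  interpret KL: module_with_submodule R "M\<lparr>carrier := ?K\<rparr>" L
    by (rule K.module_with_submoduleI[OF M.submodule_relative[OF L K iso]])
  interpret Q: chain_module R p "quot_module (M\<lparr>carrier := ?K\<rparr>) L"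
    by (intro chain_module.intro chain_ring_axioms KL.quot_is_module)
  have "p \<odot>\<^bsub>quot_module (M\<lparr>carrier := ?K\<rparr>) L\<^esub> (L +>\<^bsub>M\<^esub> x) = L"
    using Q.semisimple_module_p_torsion[OF ss] KL.coset_in_quot[of x] x by (simp add: KL.zero_quot)
  then have "L +>\<^bsub>M\<^esub> (p \<odot>\<^bsub>M\<^esub> x) = L" using KL.smult_quot[of p x] x by simp
  moreover have "p \<odot>\<^bsub>M\<^esub> x \<in> ?K" using M.submoduleE(4)[OF K] x by blast
  ultimately show ?thesis using KL.coset_eq_self_iff[of "p \<odot>\<^bsub>M\<^esub> x"] by simp
qed

text \<open>If \<open>y\<close> in \<open>lr\<^sub>d\<^sub>-\<^sub>1(M)\<close> were outside \<open>L\<close>, some \<open>x \<in> L\<^sup>\<bottom>\<close> would have \<open>\<langle>x, y\<rangle> \<noteq> 0\<close>; but \<open>p \<langle>x, x\<rangle> = 0\<close> forces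
\<open>x \<in> ur\<^sub>d\<^sub>-\<^sub>1(M)\<close>.\<close>

lemma lr_level_subset_isotropic:
  assumes iso: "mod_iso R N (ring_as_module R) \<noteq> {}" and fg: "fin_gen_module R M"
    and nondeg: "nondegenerate R M N B"
    and d: "2 \<le> d" and even: "even_tail_anisotropic R (PIdl p) M N B d"
    and odd: "odd_tail_anisotropic R (PIdl p) M N B d"
    and L: "submodule L R M" "L \<subseteq> perp M N B L"
      "semisimple_module R (quot_module (M\<lparr>carrier := perp M N B L\<rparr>) L)"
  shows "lr_level R (PIdl p) M (int d - 1) \<subseteq> L"
  unfolding lr_level_def
proof (intro M.gen_submodule_minimal[OF L(1)] UN_least subsetI)
  fix i y
  assume "y \<in> ideal_smult R M (ideal_pow R (PIdl p) i) (carrier M) \<inter>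
    ideal_tors M (ideal_pow R (PIdl p) (nat (int i - (int d - 1) + 1)))"
  moreover have "nat (int i - (int d - 1) + 1) = i + 1 - (d - 1)" using d by simp
  ultimately have y: "y \<in> M.pw i ` carrier M" "y \<in> M.tors (i + 1 - (d - 1))"
    by (simp_all only: ideal_pow_PIdl M.ideal_tors_PIdl[OF power_closed]
        M.ideal_smult_PIdl[OF power_closed M.carrier_is_submodule] Int_iff)
  then obtain c where c: "c \<in> carrier M" "y = M.pw i c" by blast
  show "y \<in> L"
  proof (rule ccontr)
    assume "y \<notin> L"
    then obtain x where x: "x \<in> perp M N B L" and ne: "B x y \<noteq> \<zero>\<^bsub>N\<^esub>"
      using nondegenerate_separates[OF iso fg nondeg L(1)] M.tors_carrier[OF y(2)] by blast
    have xc: "x \<in> carrier M" using x unfolding perp_def by blast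
    have "p \<odot>\<^bsub>M\<^esub> x \<in> L" by (rule semisimple_subquotient[OF L x])
    then have "B x (p \<odot>\<^bsub>M\<^esub> x) = \<zero>\<^bsub>N\<^esub>" using x unfolding perp_def by blast
    then have "p \<odot>\<^bsub>N\<^esub> B x x = \<zero>\<^bsub>N\<^esub>" using form_smult_right[OF uniformizer_closed xc xc] by simp
    then have "x \<in> M.ur_level (d - 1)" by (rule anisotropic_imp_in_ur_level[OF d even odd xc])
    then show False using ur_level_perp c y(2) ne by blast
  qed
qed

end

theorem theorem10p3:
  fixes R :: "('a, 'r) ring_scheme" and \<mm> :: "'a set"
    and M :: "('a, 'b, 'm) module_scheme" and N :: "('a, 'c, 'n) module_scheme"
    and B :: "'b \<Rightarrow> 'b \<Rightarrow> 'c" and d :: nat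
  assumes "local_ring \<mm> R" and "artinian_ring R" and "principal_ideal_ring R"
    and "fin_gen_module R M"
    and "module R N" and "mod_iso R N (ring_as_module R) \<noteq> {}"
    and "symmetric_bilinear_form R M N B" and "nondegenerate R M N B"
    and "2 \<le> d" and "even_tail_anisotropic R \<mm> M N B d" and "odd_tail_anisotropic R \<mm> M N B d"
    and "\<And>e. \<lbrakk>2 \<le> e; even_tail_anisotropic R \<mm> M N B e; odd_tail_anisotropic R \<mm> M N B e\<rbrakk> \<Longrightarrow> d \<le> e"
  shows "lr_level R \<mm> M (int d - 1) \<subseteq> rr R M N B"
proof -
  obtain p where p: "chain_ring R p" and \<mm>: "\<mm> = PIdl\<^bsub>R\<^esub> p"
    using local_artinian_principal_imp_chain_ring assms(1-3) by blast
  interpret chain_form R p M N B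
    by (intro chain_form.intro p assms(7))
  have "lr_level R \<mm> M (int d - 1) \<subseteq> L"
    if "submodule L R M \<and> L \<subseteq> perp M N B L \<and>
        semisimple_module R (quot_module (M\<lparr>carrier := perp M N B L\<rparr>) L)" for L
    using lr_level_subset_isotropic assms(4,6,8-11) that unfolding \<mm> by blast
  moreover have "lr_level R \<mm> M (int d - 1) \<subseteq> carrier M"
    unfolding lr_level_def
    by (intro M.gen_submodule_minimal M.carrier_is_submodule UN_least) (auto simp: ideal_tors_def)
  ultimately show ?thesis unfolding rr_def by blast
qed

end
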